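(* Let $c\geq 2$ and let $(X,* )$ be a Super Hayashi Quandle (SHQ) with $prof(X,* )=(\ell_1,\ell_2,\dots,\ell_c)$, and write $\ell:=\ell_2$. Label $X=\{1,\dots,n\}$ so that $R_1$ is in the standard form described in the context, and let $X_i=\{1,\dots,n_i\}$. Then there are a prime number $p$ and a positive integer $a$ such that: 1. $|X|=(\ell+1)^{c-1}$, where $\ell+1=p^a$; 2. $prof(X,* )=(1,\ell(\ell+1)^0,\ell(\ell+1)^1,\dots,\ell(\ell+1)^{c-2})$; 3. for each $i\in\{2,\dots,c\}$, $(X_i,* )$ is a subquandle of $(X,* )$ with $prof(X_i,* )=(1,\ell(\ell+1)^0,\dots,\ell(\ell+1)^{i-2})$. Furthermore, these are the only non-trivial subquandles of $(X,* )$ up to isomorphism, i.e. every subquandle of $(X,* )$ with at least two elements is isomorphic to $(X_i,* )$ for some $i\in\{2,\dots,c\}$.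
   Context: A quandle is a set $X$ with a binary operation $*$ such that for all $i,j,k\in X$: $i*i=i$; there is a unique $x\in X$ with $x*j=i$; and $(i*j)*k=(i*k)*(j*k)$. A subquandle is a subset that is a quandle under the restricted operation. For $i\in X$ the right translation $R_i:X\to X$ is $R_i(j)=j*i$; it is a permutation of $X$. The cycle structure of a permutation of a finite set is the list of the lengths (with multiplicity, fixed points included) of its disjoint cycles. A Super Hayashi Quandle (SHQ) is a finite quandle each of whose right translations has cycle structure of the form $(\ell_1,\ell_2,\dots,\ell_c)$ with $1=\ell_1<\ell_2<\dots<\ell_c$, $c\geq 2$, and $\ell_{i-1}\mid\ell_i$ for each $i\in\{2,\dots,c\}$. An SHQ is connected (the group generated by its right translations acts transitively), so all its right translations have the same cycle structure, called the profile and denoted $prof(X,* )$; the profile of any connected quandle is defined in the same way. Labeling: with $n=|X|$ and $n_i:=\sum_{k=1}^i\ell_k$, the elements of $X$ are labeled $X=\{1,\dots,n\}$ so that $R_1=(n_1)(n_2-\ell_2+1\ \ n_2-\ell_2+2\ \cdots\ n_2)\cdots(n_c-\ell_c+1\ \ n_c-\ell_c+2\ \cdots\ n_c)$ (possible after relabeling). Put $X_i:=\{1,\dots,n_i\}\subseteq X$ for $i\in\{1,\dots,c\}$. *)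

theory Defs
  imports
    "HOL-Algebra.Bij"
    "HOL-Algebra.Generated_Groups"
    "HOL-Combinatorics.Orbits"
    "HOL-Computational_Algebra.Primes"
    "HOL-Library.Multiset"
begin

locale quandle =
  fixes X :: "'a set" and star :: "'a \<Rightarrow> 'a \<Rightarrow> 'a" (infixl \<open>\<star>\<close> 70)
  assumes closed: "\<lbrakk>i \<in> X; j \<in> X\<rbrakk> \<Longrightarrow> i \<star> j \<in> X"
    and idem: "i \<in> X \<Longrightarrow> i \<star> i = i"
    and right_division: "\<lbrakk>i \<in> X; j \<in> X\<rbrakk> \<Longrightarrow> \<exists>!x. x \<in> X \<and> x \<star> j = i"
    and right_distrib: "\<lbrakk>i \<in> X; j \<in> X; k \<in> X\<rbrakk> \<Longrightarrow> (i \<star> j) \<star> k = (i \<star> k) \<star> (j \<star> k)"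

definition subquandle :: "'a set \<Rightarrow> 'a set \<Rightarrow> ('a \<Rightarrow> 'a \<Rightarrow> 'a) \<Rightarrow> bool" where
  "subquandle Y X star \<longleftrightarrow> Y \<subseteq> X \<and> quandle Y star"

definition quandle_isomorphic ::
    "'a set \<Rightarrow> ('a \<Rightarrow> 'a \<Rightarrow> 'a) \<Rightarrow> 'b set \<Rightarrow> ('b \<Rightarrow> 'b \<Rightarrow> 'b) \<Rightarrow> bool" where
  "quandle_isomorphic X star Y star' \<longleftrightarrow>
     (\<exists>f. bij_betw f X Y \<and> (\<forall>x\<in>X. \<forall>y\<in>X. f (star x y) = star' (f x) (f y)))"

text \<open>Translations are extensional (undefined outside \<open>X\<close>), so that they are elements of
  the permutation group \<open>BijGroup X\<close>.\<close>

definition right_translation :: "'a set \<Rightarrow> ('a \<Rightarrow> 'a \<Rightarrow> 'a) \<Rightarrow> 'a \<Rightarrow> ('a \<Rightarrow> 'a)" where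
  "right_translation X star i = (\<lambda>j\<in>X. star j i)"

definition right_translation_group :: "'a set \<Rightarrow> ('a \<Rightarrow> 'a \<Rightarrow> 'a) \<Rightarrow> ('a \<Rightarrow> 'a) set" where
  "right_translation_group X star = generate (BijGroup X) (right_translation X star ` X)"

definition connected_quandle :: "'a set \<Rightarrow> ('a \<Rightarrow> 'a \<Rightarrow> 'a) \<Rightarrow> bool" where
  "connected_quandle X star \<longleftrightarrow> quandle X star \<and>
     (\<forall>x\<in>X. \<forall>y\<in>X. \<exists>g \<in> right_translation_group X star. g x = y)"

text \<open>For a permutation \<open>f\<close> of a finite set \<open>X\<close>: the supports of the disjoint cycles, fixed points
  included, are the sets \<open>orbit f x\<close> with \<open>x \<in> X\<close>. Their sizes are listed in increasing
  order, with multiplicity.\<close>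

definition cycle_structure :: "'a set \<Rightarrow> ('a \<Rightarrow> 'a) \<Rightarrow> nat list" where
  "cycle_structure X f = sorted_list_of_multiset (image_mset card (mset_set (orbit f ` X)))"

text \<open>The profile is the cycle structure shared by all right translations; it is meaningful
  only if they do share one, as in a finite connected quandle.\<close>

definition prof :: "'a set \<Rightarrow> ('a \<Rightarrow> 'a \<Rightarrow> 'a) \<Rightarrow> nat list" where
  "prof X star = (THE L. \<forall>i\<in>X. cycle_structure X (right_translation X star i) = L)"

lemma prof_eqI:
  assumes "X \<noteq> {}" and "\<And>i. i \<in> X \<Longrightarrow> cycle_structure X (right_translation X star i) = L"
  shows "prof X star = L"
  unfolding prof_def using assms by (intro the_equality) auto

text \<open>The empty quandle, which has no right translations, is excluded. The cycle structure is not
  required to be the same for all right translations.\<close>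

definition SHQ :: "'a set \<Rightarrow> ('a \<Rightarrow> 'a \<Rightarrow> 'a) \<Rightarrow> bool" where
  "SHQ X star \<longleftrightarrow> quandle X star \<and> finite X \<and> X \<noteq> {} \<and>
     (\<forall>x\<in>X. \<exists>c\<ge>2. \<exists>l :: nat \<Rightarrow> nat.
        cycle_structure X (right_translation X star x) = map l [1..<Suc c] \<and>
        l 1 = 1 \<and> (\<forall>i\<in>{2..c}. l (i - 1) < l i \<and> l (i - 1) dvd l i))"

definition partial_sum :: "(nat \<Rightarrow> nat) \<Rightarrow> nat \<Rightarrow> nat" where
  "partial_sum l i = (\<Sum>k=1..i. l k)"

text \<open>\<open>lab\<close> attaches to each label in \<open>{1..n}\<close> an element of \<open>X\<close>, in such a way that the
  translation by the element labelled \<open>1\<close> is the product over \<open>i\<close> of the cycles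
  \<open>(n\<^sub>i - \<ell>\<^sub>i + 1, \<dots>, n\<^sub>i)\<close>, where \<open>n\<^sub>i = partial_sum l i\<close>.\<close>

definition standard_labeling ::
    "'a set \<Rightarrow> ('a \<Rightarrow> 'a \<Rightarrow> 'a) \<Rightarrow> nat \<Rightarrow> (nat \<Rightarrow> nat) \<Rightarrow> (nat \<Rightarrow> 'a) \<Rightarrow> bool" where
  "standard_labeling X star c l lab \<longleftrightarrow>
     bij_betw lab {1..card X} X \<and>
     (\<forall>i\<in>{1..c}. \<forall>k\<in>{partial_sum l i - l i + 1..partial_sum l i}.
        right_translation X star (lab 1) (lab k) =
          lab (if k = partial_sum l i then partial_sum l i - l i + 1 else k + 1))"

definition initial_part :: "(nat \<Rightarrow> nat) \<Rightarrow> (nat \<Rightarrow> 'a) \<Rightarrow> nat \<Rightarrow> 'a set" where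
  "initial_part l lab i = lab ` {1..partial_sum l i}"

end

theory Submission
  imports
    Defs
    "HOL-Combinatorics.Cycles"
    "HOL-Algebra.Sylow"
    "HOL-Algebra.Multiplicative_Group"
begin

text \<open>Write \<open>R\<^sub>x\<close> for the right translation by \<open>x\<close> and \<open>\<lambda>(x,y)\<close> for the length of the
cycle of \<open>R\<^sub>x\<close> through \<open>y\<close>. In an SHQ the cycles of each \<open>R\<^sub>x\<close> have different lengths, and these
lengths form a chain for divisibility (locale \<open>chain_quandle\<close>). A subquandle through \<open>x\<close> is a
union of cycles of \<open>R\<^sub>x\<close>, so it inherits the property, and everything can be proved by induction
on \<open>|X|\<close>. Since \<open>R\<^sub>x\<close> is an automorphism, \<open>B(x,d) = {y. \<lambda>(x,y) dvd d}\<close>, the set of fixed points of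
the \<open>d\<close>-th power of \<open>R\<^sub>x\<close>, is a subquandle; these ``blocks'' carry the proof.

\<^bold>\<open>Blocks.\<close> If \<open>B(x,d)\<close> is connected, its points see the same cycle lengths inside it, so
\<open>B(x,d) \<subseteq> B(y,d)\<close> for each \<open>y\<close> in it, and a count gives equality (\<open>block_eq\<close>). The blocks for a
fixed \<open>d\<close> thus partition \<open>X\<close>; equivalently \<open>\<lambda>\<close> is symmetric and satisfies an ultrametric
inequality for divisibility. Let \<open>l\<close> be the least length above \<open>1\<close> and \<open>q = l + 1\<close>. The smallest
blocks \<open>B(x,l)\<close> consist of \<open>x\<close> and one cycle of length \<open>l\<close>, so they have \<open>q\<close> elements and their
automorphism group is sharply 2-transitive. Of the \<open>q - 1\<close> automorphisms of such a block that
carry \<open>z\<close> to \<open>t \<noteq> z\<close>, all but one have a fixed point. Fixed-point-free automorphisms are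
therefore all conjugate and have a common order. Sylow's theorem supplies one of order \<open>p\<close> for each
prime \<open>p\<close> dividing \<open>q\<close>, so \<open>q\<close> is a prime power; and if one of them is a single \<open>q\<close>-cycle, \<open>q\<close> is
prime.

\<^bold>\<open>Connectedness.\<close> If \<open>A\<close> is a proper nonempty invariant subset and \<open>B\<close> its complement, then, as
proper blocks are connected by induction, \<open>R\<^sub>x\<close> is a single cycle on \<open>B\<close> for every \<open>x\<close> in \<open>A\<close>, and
conversely. A full cycle on \<open>A\<close> forces the least block size of \<open>A\<close> to be a prime \<open>p\<close>; by induction
\<open>|A|\<close> is a power of \<open>p\<close>, and \<open>p - 1\<close> divides \<open>|B|\<close>. Symmetrically \<open>|B|\<close> is a power of a prime
\<open>r\<close> with \<open>r - 1\<close> dividing \<open>|A|\<close>. As \<open>p, r \<ge> 3\<close>, this gives both \<open>r < p\<close> and \<open>p < r\<close>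
(\<open>indecomposable_step\<close>).

\<^bold>\<open>Lengths.\<close> If \<open>X\<close> is more than one smallest block, the smallest blocks form a congruence, and the
quotient is again a chain quandle, whose nontrivial lengths are the lengths above \<open>l\<close> divided by
\<open>q\<close> (\<open>quotient_chain_quandle\<close>). By induction the lengths of \<open>X\<close> are \<open>1\<close>, \<open>l\<close> and \<open>q l' (l'+1)^k\<close>
for \<open>k < K\<close>. That \<open>l' = l\<close> is decided in a block with the three lengths \<open>1, l, q l'\<close>: the powers of the
\<open>l'\<close>-th powers of the translations give too many automorphisms if \<open>l' > l + 1\<close>, and \<open>l\<close> divides
\<open>l'\<close> (\<open>three_lengths\<close>). Hence the lengths are \<open>1\<close> and \<open>l q^k\<close>, and \<open>|X|\<close> is their sum, a power of \<open>q\<close>.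

\<^bold>\<open>Subquandles.\<close> By the ultrametric inequality a subquandle \<open>Y\<close> through \<open>y\<close> is the block \<open>B(y,d)\<close>, where
\<open>d\<close> is the greatest length that occurs in \<open>Y\<close> (\<open>subquandle_is_block\<close>). The automorphisms of \<open>X\<close> act
transitively, so blocks for the same \<open>d\<close> are isomorphic; and the initial parts of a standard
labeling are the blocks around the element labelled \<open>1\<close>.\<close>

section \<open>Orbits of a bijection of a finite set\<close>

lemma funpow_closed:
  assumes "\<And>y. y \<in> X \<Longrightarrow> f y \<in> X" "y \<in> X" shows "(f ^^ n) y \<in> X"
  using assms(2) by (induction n) (auto intro: assms(1))

text \<open>Extending \<open>f\<close> from \<open>X\<close> by the identity gives a permutation of the whole type with the same orbits
in \<open>X\<close>, to which the theory of permutations applies.\<close>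

lemma funpow_fixed_iff_card_orbit_dvd_self:
  assumes "bij_betw f X X" "finite X" "y \<in> X"
  shows "((f ^^ n) y = y \<longleftrightarrow> card (orbit f y) dvd n) \<and> y \<in> orbit f y"
proof -
  define g where "g = (\<lambda>z. if z \<in> X then f z else z)"
  have fX: "\<And>z. z \<in> X \<Longrightarrow> f z \<in> X" using assms(1) by (auto simp: bij_betw_def)
  have "bij_betw g X X" using assms(1) by (simp add: g_def cong: bij_betw_cong)
  hence "g permutes X" by (auto simp: g_def intro!: bij_imp_permutes)
  hence perm: "permutation g" using assms(2) permutation_permutes by blast
  have pw: "(g ^^ k) y = (f ^^ k) y" for k
    by (induction k) (auto simp: g_def funpow_closed[of X f, OF fX assms(3)])
  have orb: "orbit f y = orbit g y" unfolding orbit_altdef by (simp add: pw)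
  have lp: "(g ^^ least_power g y) y = y" "0 < least_power g y"
    using least_power_of_permutation[OF perm] by auto
  have "orbit g y = set (support g y)"
    unfolding orbit_altdef_bounded[OF lp] by auto
  moreover have "card (set (support g y)) = least_power g y"
    using distinct_card[OF cycle_of_permutation[OF perm, of y]] by simp
  ultimately show ?thesis
    using least_power_dvd[OF perm, of y n] orb permutation_self_in_orbit[OF perm, of y]
    by (simp add: pw)
qed

lemmas funpow_fixed_iff_card_orbit_dvd = funpow_fixed_iff_card_orbit_dvd_self[THEN conjunct1]
lemmas self_in_orbit = funpow_fixed_iff_card_orbit_dvd_self[THEN conjunct2]

lemma orbit_subset_of_closed:
  assumes "\<And>z. z \<in> X \<Longrightarrow> f z \<in> X" "y \<in> X" shows "orbit f y \<subseteq> X"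
  using funpow_closed[of X f, OF assms] by (auto simp: orbit_altdef)

lemma orbit_eq_of_mem:
  assumes "bij_betw f X X" "finite X" "y \<in> X" "z \<in> orbit f y"
  shows "orbit f z = orbit f y"
  using orbit_cyclic_eq3[of f "orbit f y" z] self_in_orbit[OF assms(1-3)] assms(4)
  by (auto simp: cyclic_on_def)

lemma mem_orbit_iff_funpow:
  assumes "bij_betw f X X" "finite X" "y \<in> X"
  shows "z \<in> orbit f y \<longleftrightarrow> (\<exists>k. z = (f ^^ k) y)"
  using orbit_altdef_self_in[OF self_in_orbit[OF assms]] by auto

lemma card_orbit_pos:
  assumes "bij_betw f X X" "finite X" "y \<in> X"
  shows "card (orbit f y) > 0" "finite (orbit f y)"
proof -
  show f: "finite (orbit f y)"
    using finite_orbit self_in_orbit[OF assms] by metis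
  show "card (orbit f y) > 0" using self_in_orbit[OF assms] f by (auto simp: card_gt_0_iff)
qed

lemma card_orbit_eqI:
  assumes "bij_betw f X X" "finite X" "y \<in> X" "\<And>k. (f ^^ k) y = y \<longleftrightarrow> d dvd k"
  shows "card (orbit f y) = d"
  using assms(4) funpow_fixed_iff_card_orbit_dvd[OF assms(1-3)]
  by (meson dvd_antisym dvd_refl)

lemma card_partition_by_map:
  assumes "finite C" "\<And>w. w \<in> C \<Longrightarrow> card {u \<in> C. h u = h w} = q"
  shows "card C = q * card (h ` C)"
proof -
  have "card C = (\<Sum>v\<in>h ` C. card {u \<in> C. h u = v})"
    using sum.image_gen[OF assms(1), of "\<lambda>_. 1::nat" h] by simp
  also have "\<dots> = (\<Sum>v\<in>h ` C. q)"
    by (intro sum.cong refl) (use assms(2) in auto)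
  finally show ?thesis by simp
qed

lemma reps_funpow:
  fixes h :: "'a \<Rightarrow> 'a"
  assumes fX: "\<And>z. z \<in> X \<Longrightarrow> f z \<in> X"
    and h: "\<And>y. y \<in> X \<Longrightarrow> h y \<in> X" "\<And>y. y \<in> X \<Longrightarrow> h (h y) = h y"
    and cong: "\<And>y z. \<lbrakk>y \<in> X; z \<in> X; h y = h z\<rbrakk> \<Longrightarrow> h (f y) = h (f z)"
    and y: "y \<in> X"
  shows "((h \<circ> f) ^^ k) (h y) = h ((f ^^ k) y)"
proof (induction k)
  case (Suc k)
  have "(f ^^ k) y \<in> X" using funpow_closed[of X f, OF fX y] .
  thus ?case using Suc cong[of "h ((f ^^ k) y)" "(f ^^ k) y"] h by simp
qed simp

lemma reps_bij:
  fixes h :: "'a \<Rightarrow> 'a"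
  assumes bij: "bij_betw f X X" and fin: "finite X"
    and h: "\<And>y. y \<in> X \<Longrightarrow> h y \<in> X" "\<And>y. y \<in> X \<Longrightarrow> h (h y) = h y"
    and cong: "\<And>y z. \<lbrakk>y \<in> X; z \<in> X; h y = h z\<rbrakk> \<Longrightarrow> h (f y) = h (f z)"
  shows "bij_betw (h \<circ> f) (h ` X) (h ` X)"
proof -
  have step: "(h \<circ> f) (h z) = h (f z)" if "z \<in> X" for z
    using cong[of "h z" z] h that by simp
  have "(h \<circ> f) ` h ` X = h ` f ` X" using step by (simp add: image_image)
  hence im: "(h \<circ> f) ` h ` X = h ` X" using bij by (simp add: bij_betw_def)
  thus ?thesis using fin by (auto simp: bij_betw_def intro: eq_card_imp_inj_on)
qed

text \<open>Here \<open>h\<close> picks representatives of the classes of an equivalence that \<open>f\<close> respects, so \<open>h \<circ> f\<close> is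
the map induced on the classes. If the orbit of \<open>y\<close> is a union of classes of size \<open>q\<close>, the induced
orbit is shorter by the factor \<open>q\<close>, and \<open>f\<close> returns to the class of \<open>y\<close> exactly at the multiples
of the induced period.\<close>

lemma orbit_of_reps:
  fixes h :: "'a \<Rightarrow> 'a"
  assumes bij: "bij_betw f X X" and fin: "finite X"
    and h: "\<And>y. y \<in> X \<Longrightarrow> h y \<in> X" "\<And>y. y \<in> X \<Longrightarrow> h (h y) = h y"
    and cong: "\<And>y z. \<lbrakk>y \<in> X; z \<in> X; h y = h z\<rbrakk> \<Longrightarrow> h (f y) = h (f z)"
    and y: "y \<in> X"
    and fibre: "\<And>w. w \<in> orbit f y \<Longrightarrow> card {u \<in> orbit f y. h u = h w} = q"
  shows "card (orbit f y) = q * card (orbit (h \<circ> f) (h y))"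
    and "h ((f ^^ k) y) = h y \<longleftrightarrow> card (orbit (h \<circ> f) (h y)) dvd k"
proof -
  have fX: "\<And>z. z \<in> X \<Longrightarrow> f z \<in> X" using bij by (auto simp: bij_betw_def)
  have pw: "((h \<circ> f) ^^ k) (h y) = h ((f ^^ k) y)" for k
    by (rule reps_funpow[OF fX h cong y])
  have orb: "orbit (h \<circ> f) (h y) = h ` orbit f y"
    unfolding orbit_altdef by (auto simp: pw)
  show "card (orbit f y) = q * card (orbit (h \<circ> f) (h y))"
    unfolding orb by (rule card_partition_by_map[OF card_orbit_pos(2)[OF bij fin y] fibre])
  show "h ((f ^^ k) y) = h y \<longleftrightarrow> card (orbit (h \<circ> f) (h y)) dvd k"
    using funpow_fixed_iff_card_orbit_dvd[OF reps_bij[OF bij fin h cong] finite_imageI[OF fin] imageI[OF y], of k]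
    unfolding pw .
qed

lemma orbit_eq_of_full_period:
  assumes "bij_betw f Z Z" "finite Z" "z \<in> Z" "\<And>j. (f ^^ j) z = z \<longleftrightarrow> card Z dvd j"
  shows "orbit f z = Z"
proof (rule card_subset_eq[OF assms(2)])
  show "orbit f z \<subseteq> Z"
    using bij_betw_apply[OF assms(1)] assms(3) by (intro orbit_subset_of_closed)
  show "card (orbit f z) = card Z" by (rule card_orbit_eqI[OF assms])
qed

lemma mult_dvd_cancel_middle: "m > 0 \<Longrightarrow> a * m dvd m * j \<longleftrightarrow> a dvd (j :: nat)"
  by (metis mult.commute nat_mult_dvd_cancel1)

section \<open>Automorphisms and cycle lengths\<close>

text \<open>The translation as a plain function, in contrast to the extensional \<open>right_translation\<close>: its powers
and orbits do not mention the carrier, so cycle lengths are literally the same in a subquandle and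
in the whole quandle. The abbreviation is for input only, since its body would match any function.\<close>

abbreviation (input) rt :: "('a \<Rightarrow> 'a \<Rightarrow> 'a) \<Rightarrow> 'a \<Rightarrow> 'a \<Rightarrow> 'a" where
  "rt star x \<equiv> (\<lambda>y. star y x)"

definition cycle_length :: "('a \<Rightarrow> 'a \<Rightarrow> 'a) \<Rightarrow> 'a \<Rightarrow> 'a \<Rightarrow> nat" where
  "cycle_length star x y = card (orbit (rt star x) y)"

text \<open>Values outside \<open>X\<close> are unconstrained, so the same function can be an automorphism of \<open>X\<close> and of
each subquandle that it preserves.\<close>

definition automorphisms :: "'a set \<Rightarrow> ('a \<Rightarrow> 'a \<Rightarrow> 'a) \<Rightarrow> ('a \<Rightarrow> 'a) set" where
  "automorphisms X star =
     {f. bij_betw f X X \<and> (\<forall>x\<in>X. \<forall>y\<in>X. f (star x y) = star (f x) (f y))}"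

text \<open>Connectedness without reference to a group: no proper nonempty subset is invariant under all right
translations.\<close>

definition indecomposable :: "'a set \<Rightarrow> ('a \<Rightarrow> 'a \<Rightarrow> 'a) \<Rightarrow> bool" where
  "indecomposable X star \<longleftrightarrow>
     (\<forall>A\<subseteq>X. A \<noteq> {} \<and> (\<forall>a\<in>A. \<forall>y\<in>X. star a y \<in> A) \<longrightarrow> A = X)"

text \<open>The fixed points of the \<open>d\<close>-th power of the translation by \<open>x\<close>.\<close>

definition block :: "'a set \<Rightarrow> ('a \<Rightarrow> 'a \<Rightarrow> 'a) \<Rightarrow> 'a \<Rightarrow> nat \<Rightarrow> 'a set" where
  "block X star x d = {y \<in> X. cycle_length star x y dvd d}"

lemma indecomposableD:
  assumes "indecomposable X star" "A \<subseteq> X" "a \<in> A" "\<And>a y. \<lbrakk>a \<in> A; y \<in> X\<rbrakk> \<Longrightarrow> star a y \<in> A"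
  shows "A = X"
  using assms unfolding indecomposable_def by blast

lemma automorphismsI:
  "bij_betw f X X \<Longrightarrow> (\<And>x y. \<lbrakk>x \<in> X; y \<in> X\<rbrakk> \<Longrightarrow> f (star x y) = star (f x) (f y)) \<Longrightarrow>
    f \<in> automorphisms X star"
  unfolding automorphisms_def by blast

lemma automorphisms_bij: "f \<in> automorphisms X star \<Longrightarrow> bij_betw f X X"
  unfolding automorphisms_def by blast

lemma automorphisms_hom:
  "f \<in> automorphisms X star \<Longrightarrow> x \<in> X \<Longrightarrow> y \<in> X \<Longrightarrow> f (star x y) = star (f x) (f y)"
  unfolding automorphisms_def by blast

lemma automorphisms_closed: "f \<in> automorphisms X star \<Longrightarrow> x \<in> X \<Longrightarrow> f x \<in> X"
  using automorphisms_bij[THEN bij_betw_apply] .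

lemma automorphisms_inj:
  "f \<in> automorphisms X star \<Longrightarrow> x \<in> X \<Longrightarrow> y \<in> X \<Longrightarrow> f x = f y \<longleftrightarrow> x = y"
  using automorphisms_bij[THEN bij_betw_imp_inj_on, THEN inj_on_eq_iff] .

lemma automorphisms_surj:
  assumes "f \<in> automorphisms X star" "y \<in> X" shows "\<exists>x\<in>X. f x = y"
  using automorphisms_bij[OF assms(1), THEN bij_betw_imp_surj_on] assms(2) by (metis imageE)

lemma automorphisms_restrict:
  assumes "f \<in> automorphisms X star" "Y \<subseteq> X" "f ` Y = Y"
  shows "f \<in> automorphisms Y star"
proof (rule automorphismsI)
  show "bij_betw f Y Y"
    using automorphisms_bij[OF assms(1)] assms(2,3) by (rule bij_betw_subset)
qed (use automorphisms_hom[OF assms(1)] assms(2) in blast)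

lemma automorphisms_comp:
  assumes "f \<in> automorphisms X star" "g \<in> automorphisms X star"
  shows "f \<circ> g \<in> automorphisms X star"
proof (rule automorphismsI)
  show "bij_betw (f \<circ> g) X X" using assms[THEN automorphisms_bij] bij_betw_trans by blast
qed (simp add: automorphisms_hom[OF assms(1)] automorphisms_hom[OF assms(2)]
      automorphisms_closed[OF assms(2)])

lemma automorphisms_id: "id \<in> automorphisms X star"
  by (rule automorphismsI) auto

lemma automorphisms_funpow:
  assumes "f \<in> automorphisms X star"
  shows "f ^^ k \<in> automorphisms X star"
proof (induction k)
  case 0 show ?case using automorphisms_id by (simp add: id_def)
next
  case (Suc k) show ?case using automorphisms_comp[OF assms Suc] by (simp add: o_def)
qed

lemma automorphisms_inv:
  assumes cl: "\<And>x y. \<lbrakk>x \<in> X; y \<in> X\<rbrakk> \<Longrightarrow> star x y \<in> X" and f: "f \<in> automorphisms X star"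
  shows "inv_into X f \<in> automorphisms X star"
proof -
  have b: "bij_betw f X X" using automorphisms_bij[OF f] .
  have "inv_into X f (star x y) = star (inv_into X f x) (inv_into X f y)" if x: "x \<in> X" and y: "y \<in> X" for x y
  proof -
    obtain u v where uv: "u \<in> X" "f u = x" "v \<in> X" "f v = y"
      using automorphisms_surj[OF f x] automorphisms_surj[OF f y] by blast
    have "star x y = f (star u v)" using uv automorphisms_hom[OF f] by simp
    hence "inv_into X f (star x y) = star u v"
      using cl[OF uv(1,3)] bij_betw_inv_into_left[OF b] by simp
    thus ?thesis using uv bij_betw_inv_into_left[OF b] by auto
  qed
  thus ?thesis using bij_betw_inv_into[OF b] by (intro automorphismsI)
qed

locale finite_quandle = quandle +
  assumes finite: "finite X"
begin

lemma rt_automorphism: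
  assumes x: "x \<in> X"
  shows "rt (\<star>) x \<in> automorphisms X (\<star>)"
proof -
  have "(\<lambda>y. y \<star> x) ` X = X"
  proof (intro equalityI subsetI)
    fix z assume "z \<in> X"
    then obtain y where "y \<in> X" "y \<star> x = z" using right_division[OF _ x] by blast
    thus "z \<in> (\<lambda>y. y \<star> x) ` X" by blast
  qed (use closed[OF _ x] in blast)
  moreover have "inj_on (\<lambda>y. y \<star> x) X"
  proof (rule inj_onI)
    fix y z assume "y \<in> X" "z \<in> X" "y \<star> x = z \<star> x"
    thus "y = z" using right_division[OF closed[OF \<open>z \<in> X\<close> x] x] by blast
  qed
  ultimately show ?thesis using right_distrib[OF _ _ x]
    by (intro automorphismsI bij_betw_imageI)
qed

lemmas rt_bij = automorphisms_bij[OF rt_automorphism]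

lemma rt_funpow_closed: "x \<in> X \<Longrightarrow> y \<in> X \<Longrightarrow> (rt (\<star>) x ^^ k) y \<in> X"
  by (intro funpow_closed) (auto intro: closed)

lemma rt_funpow_self: "x \<in> X \<Longrightarrow> (rt (\<star>) x ^^ k) x = x"
  by (induction k) (auto simp: idem)

lemma subquandleI:
  assumes "Y \<subseteq> X" "\<And>x y. \<lbrakk>x \<in> Y; y \<in> Y\<rbrakk> \<Longrightarrow> x \<star> y \<in> Y"
  shows "finite_quandle Y (\<star>)"
proof -
  have fin: "finite Y" using assms(1) finite finite_subset by auto
  have "\<exists>!x. x \<in> Y \<and> x \<star> j = i" if "i \<in> Y" "j \<in> Y" for i j
  proof -
    have inj: "inj_on (\<lambda>x. x \<star> j) Y"
      using rt_bij[of j] that assms(1) by (auto simp: bij_betw_def intro: inj_on_subset)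
    hence "(\<lambda>x. x \<star> j) ` Y = Y"
      using fin assms(2) that(2) by (intro endo_inj_surj) auto
    hence "i \<in> (\<lambda>x. x \<star> j) ` Y" using that(1) by simp
    then obtain x where "x \<in> Y" "x \<star> j = i" by (elim imageE) simp
    thus ?thesis using inj_onD[OF inj] by (intro ex1I[of _ x]) auto
  qed
  moreover have "(i \<star> j) \<star> k = (i \<star> k) \<star> (j \<star> k)" if "i \<in> Y" "j \<in> Y" "k \<in> Y" for i j k
    using right_distrib subsetD[OF assms(1)] that by blast
  moreover have "i \<star> i = i" if "i \<in> Y" for i
    using idem subsetD[OF assms(1) that] by blast
  ultimately show ?thesis
    using assms(2) fin
    by (intro finite_quandle.intro quandle.intro finite_quandle_axioms.intro)
qed

lemma automorphism_conj_funpow: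
  assumes f: "f \<in> automorphisms X (\<star>)" and "x \<in> X" "y \<in> X"
  shows "f ((rt (\<star>) x ^^ k) y) = (rt (\<star>) (f x) ^^ k) (f y)"
  using assms(2,3) by (induction k) (auto simp: automorphisms_hom[OF f] rt_funpow_closed)

lemma mem_cycle_iff:
  assumes "x \<in> X" "y \<in> X"
  shows "z \<in> orbit (rt (\<star>) x) y \<longleftrightarrow> (\<exists>k. z = (rt (\<star>) x ^^ k) y)"
  using mem_orbit_iff_funpow[OF rt_bij[OF assms(1)] finite assms(2)] .

lemma cycle_subset: "x \<in> X \<Longrightarrow> y \<in> X \<Longrightarrow> orbit (rt (\<star>) x) y \<subseteq> X"
  by (intro orbit_subset_of_closed) (auto intro: closed)

lemma self_in_cycle: "x \<in> X \<Longrightarrow> y \<in> X \<Longrightarrow> y \<in> orbit (rt (\<star>) x) y"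
  by (rule self_in_orbit[OF rt_bij finite])

text \<open>The cycle of \<open>R\<^sub>x\<close> through \<open>y\<close> is generated from the pair \<open>(x,y)\<close> by the quandle operation, so the
images of \<open>x\<close> and \<open>y\<close> determine an automorphism on that cycle.\<close>

lemma automorphisms_agree_on_cycle:
  assumes "f \<in> automorphisms X (\<star>)" "g \<in> automorphisms X (\<star>)" "x \<in> X" "y \<in> X"
    and "f x = g x" "f y = g y" and z: "z \<in> orbit (rt (\<star>) x) y"
  shows "f z = g z"
proof -
  obtain k where "z = (rt (\<star>) x ^^ k) y" using z mem_cycle_iff[OF assms(3,4)] by auto
  thus ?thesis
    using automorphism_conj_funpow[OF assms(1,3,4), of k] automorphism_conj_funpow[OF assms(2,3,4), of k]
      assms(5,6) by simp
qed

lemma cycle_length_dvd_iff: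
  assumes "x \<in> X" "y \<in> X"
  shows "cycle_length (\<star>) x y dvd k \<longleftrightarrow> (rt (\<star>) x ^^ k) y = y"
  unfolding cycle_length_def using funpow_fixed_iff_card_orbit_dvd[OF rt_bij[OF assms(1)] finite assms(2)] ..

lemma cycle_length_pos: "x \<in> X \<Longrightarrow> y \<in> X \<Longrightarrow> cycle_length (\<star>) x y > 0"
  unfolding cycle_length_def by (rule card_orbit_pos(1)[OF rt_bij finite])

lemma cycle_length_self: assumes "x \<in> X" shows "cycle_length (\<star>) x x = 1"
  using cycle_length_dvd_iff[OF assms assms, of 1] idem[OF assms] by simp

lemma cycle_length_of_mem:
  "x \<in> X \<Longrightarrow> y \<in> X \<Longrightarrow> z \<in> orbit (rt (\<star>) x) y \<Longrightarrow> cycle_length (\<star>) x z = cycle_length (\<star>) x y"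
  unfolding cycle_length_def using orbit_eq_of_mem[OF rt_bij finite] by metis

lemma cycle_length_automorphism:
  assumes f: "f \<in> automorphisms X (\<star>)" and "x \<in> X" "y \<in> X"
  shows "cycle_length (\<star>) (f x) (f y) = cycle_length (\<star>) x y"
proof -
  have "cycle_length (\<star>) (f x) (f y) dvd k \<longleftrightarrow> cycle_length (\<star>) x y dvd k" for k
    using assms automorphisms_closed[OF f]
    by (simp add: cycle_length_dvd_iff automorphism_conj_funpow[OF f, symmetric]
        automorphisms_inj[OF f] rt_funpow_closed)
  thus ?thesis by (meson dvd_antisym dvd_refl)
qed

lemma block_eq_fixed_points: "x \<in> X \<Longrightarrow> block X (\<star>) x d = {y \<in> X. (rt (\<star>) x ^^ d) y = y}"
  by (auto simp: block_def cycle_length_dvd_iff)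

lemma self_in_block: "x \<in> X \<Longrightarrow> x \<in> block X (\<star>) x d"
  by (simp add: block_def cycle_length_self)

lemma block_subset: "block X (\<star>) x d \<subseteq> X"
  by (auto simp: block_def)

lemma block_quandle:
  assumes "x \<in> X" shows "finite_quandle (block X (\<star>) x d) (\<star>)"
  using automorphisms_hom[OF automorphisms_funpow[OF rt_automorphism[OF assms]]] closed
  by (intro subquandleI) (auto simp: block_eq_fixed_points[OF assms])

lemma block_automorphism_image:
  assumes f: "f \<in> automorphisms X (\<star>)" and "x \<in> X"
  shows "f ` block X (\<star>) x d = block X (\<star>) (f x) d"
proof (intro equalityI subsetI)
  fix y assume "y \<in> block X (\<star>) (f x) d"
  thus "y \<in> f ` block X (\<star>) x d"
    using automorphisms_surj[OF f, of y] cycle_length_automorphism[OF f assms(2)]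
    by (auto simp: block_def image_iff)
qed (use cycle_length_automorphism[OF f assms(2)] automorphisms_closed[OF f] in \<open>auto simp: block_def\<close>)

text \<open>The orbit of \<open>x\<close> under the automorphisms is invariant under right translations, as these are
automorphisms themselves.\<close>

lemma indecomposable_transitive:
  assumes "indecomposable X (\<star>)" "x \<in> X" "y \<in> X"
  shows "\<exists>f\<in>automorphisms X (\<star>). f x = y"
proof -
  let ?A = "(\<lambda>f. f x) ` automorphisms X (\<star>)"
  have "?A \<subseteq> X" using assms(2) automorphisms_closed by fastforce
  moreover have "id x \<in> ?A" using automorphisms_id by blast
  moreover have "a \<star> z \<in> ?A" if "a \<in> ?A" "z \<in> X" for a z
  proof -
    obtain f where "f \<in> automorphisms X (\<star>)" "a = f x" using \<open>a \<in> ?A\<close> by blast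
    thus ?thesis
      using imageI[OF automorphisms_comp[OF rt_automorphism[OF \<open>z \<in> X\<close>]], of f "\<lambda>f. f x"] by simp
  qed
  ultimately have "?A = X" by (rule indecomposableD[OF assms(1)])
  hence "y \<in> ?A" using assms(3) by simp
  thus ?thesis by (elim imageE) (metis)
qed

lemma cycle_lengths_eq:
  assumes "indecomposable X (\<star>)" "x \<in> X" "y \<in> X"
  shows "cycle_length (\<star>) x ` X = cycle_length (\<star>) y ` X"
proof -
  obtain f where f: "f \<in> automorphisms X (\<star>)" "f x = y"
    using indecomposable_transitive[OF assms] by (elim bexE)
  have "cycle_length (\<star>) y ` X = cycle_length (\<star>) y ` f ` X"
    using automorphisms_bij[OF f(1)] by (simp add: bij_betw_def)
  also have "\<dots> = cycle_length (\<star>) x ` X"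
    using cycle_length_automorphism[OF f(1) assms(2)] f(2) by (auto simp: image_image)
  finally show ?thesis ..
qed

end

section \<open>Quandles of cyclic type\<close>

lemma funpow_cong_on:
  assumes "\<And>x. x \<in> X \<Longrightarrow> f x = g x" "\<And>x. x \<in> X \<Longrightarrow> g x \<in> X" "x \<in> X"
  shows "(f ^^ n) x = (g ^^ n) x"
proof (induction n)
  case (Suc n)
  thus ?case using assms(1) funpow_closed[of X g, OF assms(2,3)] by simp
qed simp

text \<open>Connected quandles of cyclic type: a translation fixes one point and permutes all the others in one cycle.
The smallest blocks of a chain quandle have this form.\<close>

locale cyclic_quandle = finite_quandle +
  assumes indec: "indecomposable X (\<star>)"
    and one_cycle: "\<lbrakk>x \<in> X; y \<in> X; y \<noteq> x\<rbrakk> \<Longrightarrow> cycle_length (\<star>) x y = card X - 1"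
    and card_ge_3: "card X \<ge> 3"
begin

lemma cycle_eq: assumes "x \<in> X" "y \<in> X" "y \<noteq> x" shows "orbit (rt (\<star>) x) y = X - {x}"
proof (rule card_subset_eq)
  have "x \<notin> orbit (rt (\<star>) x) y"
    using cycle_length_of_mem[OF assms(1,2), of x] cycle_length_self[OF assms(1)] one_cycle[OF assms] card_ge_3
    by auto
  thus "orbit (rt (\<star>) x) y \<subseteq> X - {x}" using cycle_subset[OF assms(1,2)] by auto
  show "card (orbit (rt (\<star>) x) y) = card (X - {x})"
    using one_cycle[OF assms] assms(1) finite by (simp add: cycle_length_def)
qed (simp add: finite)

text \<open>With \<open>two_transitive\<close>, this says that the automorphism group is sharply 2-transitive.\<close>

lemma automorphisms_eqI:
  assumes "f \<in> automorphisms X (\<star>)" "g \<in> automorphisms X (\<star>)"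
    and "x \<in> X" "y \<in> X" "y \<noteq> x" "f x = g x" "f y = g y" "z \<in> X"
  shows "f z = g z"
proof (cases "z = x")
  case False
  thus ?thesis
    using automorphisms_agree_on_cycle[OF assms(1-4,6,7)] cycle_eq[OF assms(3-5)] assms(8) by simp
qed (use assms in simp)

lemma two_transitive:
  assumes "x \<in> X" "y \<in> X" "y \<noteq> x" "u \<in> X" "v \<in> X" "v \<noteq> u"
  shows "\<exists>f\<in>automorphisms X (\<star>). f x = u \<and> f y = v"
proof -
  obtain f where f: "f \<in> automorphisms X (\<star>)" "f x = u"
    using indecomposable_transitive[OF indec assms(1,4)] by (elim bexE)
  have fy: "f y \<in> X" "f y \<noteq> u"
    using automorphisms_closed[OF f(1) assms(2)] automorphisms_inj[OF f(1) assms(2,1)] f(2) assms(3) by auto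
  obtain k where k: "v = (rt (\<star>) u ^^ k) (f y)"
    using cycle_eq[OF assms(4) fy] mem_cycle_iff[OF assms(4) fy(1), of v] assms(5,6) by auto
  have "rt (\<star>) u ^^ k \<circ> f \<in> automorphisms X (\<star>)"
    by (rule automorphisms_comp[OF automorphisms_funpow[OF rt_automorphism[OF assms(4)]] f(1)])
  moreover have "(rt (\<star>) u ^^ k \<circ> f) x = u" using f(2) rt_funpow_self[OF assms(4)] by simp
  moreover have "(rt (\<star>) u ^^ k \<circ> f) y = v" using k by simp
  ultimately show ?thesis by blast
qed

definition fpf_automorphisms :: "('a \<Rightarrow> 'a) set" where
  "fpf_automorphisms = {g \<in> automorphisms X (\<star>). \<forall>z\<in>X. g z \<noteq> z}"

text \<open>Let \<open>q = |X|\<close> and \<open>t = g z = h z\<close>. For each of the \<open>q - 2\<close> points \<open>w\<close> other than \<open>z\<close> and \<open>t\<close> there is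
exactly one automorphism \<open>F w\<close> with \<open>z \<mapsto> t\<close> that fixes \<open>w\<close>. An automorphism with \<open>z \<mapsto> t\<close> is determined
by its value at a second point \<open>u\<close>, which differs from \<open>t\<close>, so there are at most \<open>q - 1\<close> of them.
This leaves room for only one without fixed points.\<close>

lemma fpf_automorphisms_eqI:
  assumes g: "g \<in> fpf_automorphisms" and h: "h \<in> fpf_automorphisms"
    and z: "z \<in> X" "g z = h z" and u: "u \<in> X"
  shows "g u = h u"
proof (rule ccontr)
  assume neq: "g u \<noteq> h u"
  have gA: "g \<in> automorphisms X (\<star>)" and gf: "\<And>w. w \<in> X \<Longrightarrow> g w \<noteq> w"
    and hA: "h \<in> automorphisms X (\<star>)" and hf: "\<And>w. w \<in> X \<Longrightarrow> h w \<noteq> w"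
    using g h by (auto simp: fpf_automorphisms_def)
  define t where "t = g z"
  have t: "t \<in> X" "t \<noteq> z" unfolding t_def using automorphisms_closed[OF gA z(1)] gf[OF z(1)] by auto
  have uz: "u \<noteq> z" using neq z by auto
  define W where "W = X - {z, t}"
  have "\<exists>f\<in>automorphisms X (\<star>). f z = t \<and> f w = w" if "w \<in> W" for w
    using two_transitive[of z w t w] that z(1) t unfolding W_def by auto
  then obtain F where F: "\<And>w. w \<in> W \<Longrightarrow> F w \<in> automorphisms X (\<star>)"
    "\<And>w. w \<in> W \<Longrightarrow> F w z = t" "\<And>w. w \<in> W \<Longrightarrow> F w w = w" by metis
  have WX: "w \<in> X" "w \<noteq> z" if "w \<in> W" for w using that by (auto simp: W_def)
  have inj: "inj_on (\<lambda>w. F w u) W"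
  proof (rule inj_onI, rule ccontr)
    fix w w' assume w: "w \<in> W" and w': "w' \<in> W" and eq: "F w u = F w' u" and ne: "w \<noteq> w'"
    have "F w' w = F w w"
      using F(2)[OF w] F(2)[OF w'] eq by (intro automorphisms_eqI[OF F(1)[OF w'] F(1)[OF w] z(1) u uz _ _ WX(1)[OF w]]) simp_all
    hence "F w' w = id w" using F(3)[OF w] by simp
    hence "F w' z = id z"
      using F(3)[OF w']
      by (intro automorphisms_eqI[OF F(1)[OF w'] automorphisms_id WX(1)[OF w'] WX(1)[OF w] ne _ _ z(1)]) simp_all
    thus False using F(2)[OF w'] t(2) by simp
  qed
  have avoid: "f u \<notin> (\<lambda>w. F w u) ` W" if f: "f \<in> automorphisms X (\<star>)" "\<And>w. w \<in> X \<Longrightarrow> f w \<noteq> w" "f z = t" for f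
  proof
    assume "f u \<in> (\<lambda>w. F w u) ` W"
    then obtain w where w: "w \<in> W" "f u = F w u" by (elim imageE)
    have "f w = F w w"
      using f(3) F(2)[OF w(1)] w(2) by (intro automorphisms_eqI[OF f(1) F(1)[OF w(1)] z(1) u uz _ _ WX(1)[OF w(1)]]) simp_all
    thus False using F(3)[OF w(1)] f(2)[OF WX(1)[OF w(1)]] by simp
  qed
  have img: "f u \<in> X - {t}" if f: "f \<in> automorphisms X (\<star>)" "f z = t" for f
    using automorphisms_closed[OF f(1) u] automorphisms_inj[OF f(1) u z(1)] f(2) uz by auto
  have finW: "finite W" unfolding W_def using finite by simp
  have "card W = card X - 2"
    unfolding W_def using z(1) t finite by (simp add: card_Diff_subset)
  \<comment> \<open>\<open>q\<close> different values in the \<open>(q - 1)\<close>-element set \<open>X - {t}\<close>.\<close>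
  have "card (insert (g u) (insert (h u) ((\<lambda>w. F w u) ` W))) = card W + 2"
    using neq avoid[OF gA gf] avoid[OF hA hf] z(2) finW card_image[OF inj] by (simp add: t_def)
  moreover have "insert (g u) (insert (h u) ((\<lambda>w. F w u) ` W)) \<subseteq> X - {t}"
    using img[OF gA t_def[symmetric]] img[OF hA z(2)[folded t_def, symmetric]] img[OF F(1) F(2)]
    by (intro insert_subsetI image_subsetI)
  ultimately have "card W + 2 \<le> card (X - {t})"
    using card_mono[OF finite_Diff[OF finite]] by metis
  thus False using \<open>card W = card X - 2\<close> card_ge_3 t(1) finite by simp
qed

text \<open>Conjugating \<open>S\<close> by an automorphism \<open>P\<close> with \<open>P u = u\<close> and \<open>P (S u) = T u\<close> gives a fixed-point-free
automorphism that agrees with \<open>T\<close> at \<open>u\<close>, hence everywhere.\<close>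

lemma fpf_automorphisms_order:
  assumes S: "S \<in> fpf_automorphisms" and T: "T \<in> fpf_automorphisms"
    and n: "\<And>w. w \<in> X \<Longrightarrow> (S ^^ n) w = w" and u: "u \<in> X"
  shows "(T ^^ n) u = u"
proof -
  have SA: "S \<in> automorphisms X (\<star>)" and Sf: "\<And>w. w \<in> X \<Longrightarrow> S w \<noteq> w"
    and TA: "T \<in> automorphisms X (\<star>)" and Tf: "\<And>w. w \<in> X \<Longrightarrow> T w \<noteq> w"
    using S T by (auto simp: fpf_automorphisms_def)
  obtain P where P: "P \<in> automorphisms X (\<star>)" "P u = u" "P (S u) = T u"
    using two_transitive[OF u automorphisms_closed[OF SA u] Sf[OF u] u automorphisms_closed[OF TA u] Tf[OF u]]
    by auto
  let ?I = "inv_into X P"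
  have I: "?I \<in> automorphisms X (\<star>)" using automorphisms_inv[OF closed P(1)] .
  note b = automorphisms_bij[OF P(1)]
  have PI: "P (?I w) = w" if "w \<in> X" for w using bij_betw_inv_into_right[OF b that] .
  have IP: "?I (P w) = w" if "w \<in> X" for w using bij_betw_inv_into_left[OF b that] .
  have Iu: "?I u = u" using IP[OF u] P(2) by simp
  define S' where "S' = P \<circ> (S \<circ> ?I)"
  have S'A: "S' \<in> automorphisms X (\<star>)"
    unfolding S'_def by (intro automorphisms_comp P(1) SA I)
  have "S' w \<noteq> w" if w: "w \<in> X" for w
  proof
    assume "S' w = w"
    hence "P (S (?I w)) = P (?I w)" using PI[OF w] by (simp add: S'_def)
    thus False
      using automorphisms_inj[OF P(1)] automorphisms_closed[OF I w] automorphisms_closed[OF SA] Sf by metis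
  qed
  hence "S' \<in> fpf_automorphisms" using S'A by (simp add: fpf_automorphisms_def)
  moreover have "S' u = T u" unfolding S'_def using Iu P(3) by simp
  ultimately have eq: "T w = S' w" if "w \<in> X" for w
    using fpf_automorphisms_eqI[OF _ T u _ that] by simp
  have "(T ^^ k) u = P ((S ^^ k) u)" for k
  proof (induction k)
    case (Suc k)
    have "(S ^^ k) u \<in> X" using automorphisms_closed[OF automorphisms_funpow[OF SA] u] .
    thus ?case using Suc eq[of "P ((S ^^ k) u)"] automorphisms_closed[OF P(1)] IP by (simp add: S'_def)
  qed (simp add: P(2))
  thus ?thesis using n[OF u] P(2) by simp
qed

text \<open>For a prime factor \<open>p\<close> of \<open>q = |X|\<close>, the power \<open>T^(q/p)\<close> is fixed-point-free of order \<open>p\<close>. So \<open>T\<close> has order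
\<open>p\<close> as well, and \<open>q = p\<close>.\<close>

lemma prime_card_of_full_cycle:
  assumes T: "T \<in> automorphisms X (\<star>)" and cyc: "\<And>z k. z \<in> X \<Longrightarrow> (T ^^ k) z = z \<longleftrightarrow> card X dvd k"
  shows "prime (card X)"
proof -
  obtain z where z: "z \<in> X" using card_ge_3 by fastforce
  obtain p where p: "prime p" "p dvd card X" using card_ge_3 prime_factor_nat[of "card X"] by auto
  obtain s where s: "card X = p * s" using p(2) by (elim dvdE)
  have "s > 0" "s < card X" using s card_ge_3 prime_gt_1_nat[OF p(1)] by (auto intro: Nat.gr0I)
  hence "\<not> card X dvd s" by (auto dest: dvd_imp_le)
  hence "T ^^ s \<in> fpf_automorphisms"
    using cyc automorphisms_funpow[OF T] by (simp add: fpf_automorphisms_def)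
  moreover have "T \<in> fpf_automorphisms"
    using cyc[of _ 1] T card_ge_3 by (auto simp: fpf_automorphisms_def)
  moreover have "((T ^^ s) ^^ p) w = w" if "w \<in> X" for w
    using cyc[OF that, of "p * s"] s by (simp add: funpow_mult mult.commute)
  ultimately have "(T ^^ p) z = z" using fpf_automorphisms_order z by blast
  hence "card X dvd p" using cyc[OF z] by simp
  thus ?thesis using p dvd_antisym by blast
qed

text \<open>By sharp 2-transitivity there are \<open>q (q - 1)\<close> automorphisms, \<open>q = |X|\<close>, so Sylow's theorem yields one of
order \<open>p\<close>. If it fixed a point \<open>w\<close>, it would be a power of the translation by \<open>w\<close>, whose order
\<open>q - 1\<close> is prime to \<open>p\<close>.\<close>

lemma prime_order_fpf_automorphism:
  assumes p: "prime p" "p dvd card X"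
  shows "\<exists>h\<in>fpf_automorphisms. \<forall>w\<in>X. (h ^^ p) w = w"
proof -
  define K where "K = {f \<in> Bij X. f \<in> automorphisms X (\<star>)}"
  define G where "G = (BijGroup X)\<lparr>carrier := K\<rparr>"
  have restr: "restrict f X \<in> K" if "f \<in> automorphisms X (\<star>)" for f
  proof -
    have "bij_betw (restrict f X) X X" using automorphisms_bij[OF that] by simp
    moreover have "restrict f X \<in> automorphisms X (\<star>)"
      using calculation closed automorphisms_hom[OF that] by (intro automorphismsI) auto
    ultimately show ?thesis by (simp add: K_def Bij_def)
  qed
  have compose_K: "compose X f g \<in> K" if "f \<in> K" "g \<in> K" for f g
  proof -
    have "restrict (f \<circ> g) X \<in> K" using that restr automorphisms_comp unfolding K_def by blast
    thus ?thesis by (simp add: compose_def restrict_def o_def)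
  qed
  have sub: "subgroup K (BijGroup X)"
  proof (rule group.subgroupI[OF group_BijGroup])
    show "K \<subseteq> carrier (BijGroup X)" by (auto simp: K_def BijGroup_def)
    show "K \<noteq> {}" using restr[OF automorphisms_id] by auto
    fix f assume f: "f \<in> K"
    show "inv\<^bsub>BijGroup X\<^esub> f \<in> K"
      using f restr[OF automorphisms_inv[OF closed]] unfolding K_def by (simp add: inv_BijGroup)
    fix g assume g: "g \<in> K"
    show "f \<otimes>\<^bsub>BijGroup X\<^esub> g \<in> K"
      using compose_K[OF f g] f g by (simp add: BijGroup_def K_def)
  qed
  have G: "group G" unfolding G_def by (rule subgroup.subgroup_is_group[OF sub group_BijGroup])
  obtain x where x: "x \<in> X" using card_ge_3 by fastforce
  have "card (X - {x}) > 0" using card_ge_3 x finite by simp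
  then obtain y where y: "y \<in> X" "y \<noteq> x" by (auto simp: card_gt_0_iff)
  have "bij_betw (\<lambda>f. (f x, f y)) K (Sigma X (\<lambda>u. X - {u}))"
  proof (rule bij_betw_imageI)
    show "inj_on (\<lambda>f. (f x, f y)) K"
    proof (rule inj_onI)
      fix f g assume f: "f \<in> K" and g: "g \<in> K" and eq: "(f x, f y) = (g x, g y)"
      have "f z = g z" if "z \<in> X" for z
        using f g eq automorphisms_eqI[OF _ _ x y(1) y(2) _ _ that, of f g] by (simp add: K_def)
      thus "f = g" using f g by (intro extensionalityI[of f X g]) (simp_all add: K_def Bij_def)
    qed
    show "(\<lambda>f. (f x, f y)) ` K = Sigma X (\<lambda>u. X - {u})"
    proof (intro equalityI subsetI)
      fix v assume "v \<in> (\<lambda>f. (f x, f y)) ` K"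
      then obtain f where f: "f \<in> automorphisms X (\<star>)" "v = (f x, f y)" by (auto simp: K_def)
      thus "v \<in> Sigma X (\<lambda>u. X - {u})"
        using automorphisms_closed[OF f(1) x] automorphisms_closed[OF f(1) y(1)]
          automorphisms_inj[OF f(1) y(1) x] y(2) by simp
    next
      fix v assume v: "v \<in> Sigma X (\<lambda>u. X - {u})"
      obtain a b where ab: "v = (a, b)" by (cases v)
      have "a \<in> X" "b \<in> X" "b \<noteq> a" using v ab by auto
      then obtain f where f: "f \<in> automorphisms X (\<star>)" "f x = a" "f y = b"
        using two_transitive[OF x y] by metis
      have "v = (restrict f X x, restrict f X y)" using f(2,3) ab x y(1) by simp
      thus "v \<in> (\<lambda>f. (f x, f y)) ` K" using restr[OF f(1)] by (rule image_eqI)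
    qed
  qed
  hence cardK: "card K = card (Sigma X (\<lambda>u. X - {u}))" by (rule bij_betw_same_card)
  also have "\<dots> = (\<Sum>u\<in>X. card X - 1)"
    using finite by (simp add: card_SigmaI)
  finally have cardK: "card K = card X * (card X - 1)" by simp
  obtain s where s: "card X = p * s" using p(2) by (elim dvdE)
  have "order G = p ^ 1 * (s * (card X - 1))"
    using cardK s by (simp add: order_def G_def)
  moreover have "finite (carrier G)"
    using cardK card_ge_3 by (intro card_ge_0_finite) (simp add: G_def)
  ultimately obtain H where H: "subgroup H G" "card H = p ^ 1"
    using sylow_thm[OF p(1) G] by blast
  have HK: "H \<subseteq> K" using subgroup.subset[OF H(1)] by (simp add: G_def)
  interpret GH: group "G\<lparr>carrier := H\<rparr>" by (rule subgroup.subgroup_is_group[OF H(1) G])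
  \<comment> \<open>\<open>H\<close> has \<open>p > 1\<close> elements.\<close>
  have "\<exists>h\<in>H. h \<noteq> \<one>\<^bsub>G\<^esub>"
  proof (rule ccontr)
    assume "\<not> ?thesis"
    hence "H \<subseteq> {\<one>\<^bsub>G\<^esub>}" by auto
    hence "card H \<le> 1" using card_mono[of "{\<one>\<^bsub>G\<^esub>}" H] by simp
    thus False using H(2) prime_gt_1_nat[OF p(1)] by simp
  qed
  then obtain h where h: "h \<in> H" "h \<noteq> \<one>\<^bsub>G\<^esub>" by auto
  have hK: "h \<in> K" using h HK by auto
  have hA: "h \<in> automorphisms X (\<star>)" and hB: "h \<in> Bij X" using hK by (auto simp: K_def)
  have mult_eq: "f \<otimes>\<^bsub>G\<lparr>carrier := H\<rparr>\<^esub> g = compose X f g" if "f \<in> Bij X" "g \<in> Bij X" for f g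
    using that by (simp add: G_def BijGroup_def)
  have pow: "h [^]\<^bsub>G\<lparr>carrier := H\<rparr>\<^esub> n \<in> H \<and> (\<forall>w\<in>X. (h [^]\<^bsub>G\<lparr>carrier := H\<rparr>\<^esub> n) w = (h ^^ n) w)" for n :: nat
  proof (induction n)
    case 0
    have "\<one>\<^bsub>G\<lparr>carrier := H\<rparr>\<^esub> \<in> H" using GH.one_closed by simp
    thus ?case by (simp add: G_def BijGroup_def restrict_def)
  next
    case (Suc n)
    have "h [^]\<^bsub>G\<lparr>carrier := H\<rparr>\<^esub> Suc n \<in> H" using GH.nat_pow_closed[of h "Suc n"] h(1) by simp
    moreover have "(h [^]\<^bsub>G\<lparr>carrier := H\<rparr>\<^esub> n) \<in> Bij X"
      using subsetD[OF HK Suc[THEN conjunct1]] by (simp add: K_def)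
    hence cmp: "h [^]\<^bsub>G\<lparr>carrier := H\<rparr>\<^esub> Suc n = compose X (h [^]\<^bsub>G\<lparr>carrier := H\<rparr>\<^esub> n) h"
      unfolding GH.nat_pow_Suc using hB by (rule mult_eq)
    moreover have "(h [^]\<^bsub>G\<lparr>carrier := H\<rparr>\<^esub> Suc n) w = (h ^^ Suc n) w" if "w \<in> X" for w
      unfolding cmp using Suc automorphisms_closed[OF hA that] that by (simp add: compose_eq funpow_swap1)
    ultimately show ?case by blast
  qed
  have "h [^]\<^bsub>G\<lparr>carrier := H\<rparr>\<^esub> p = \<one>\<^bsub>G\<^esub>"
    using GH.pow_order_eq_1[of h] h(1) H(2) by (simp add: order_def)
  hence hp: "(h ^^ p) w = w" if "w \<in> X" for w
    using pow[of p] that by (simp add: G_def BijGroup_def)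
  have "h w \<noteq> w" if w: "w \<in> X" for w
  proof
    assume fix_w: "h w = w"
    have "card (X - {w}) > 0" using card_ge_3 w finite by simp
    then obtain v where v: "v \<in> X" "v \<noteq> w" by (auto simp: card_gt_0_iff)
    have hv: "h v \<in> X" "h v \<noteq> w"
      using automorphisms_closed[OF hA v(1)] automorphisms_inj[OF hA v(1) w] fix_w v(2) by auto
    obtain k where k: "h v = (rt (\<star>) w ^^ k) v"
      using cycle_eq[OF w v] mem_cycle_iff[OF w v(1), of "h v"] hv by auto
    have R: "rt (\<star>) w ^^ k \<in> automorphisms X (\<star>)" using automorphisms_funpow[OF rt_automorphism[OF w]] .
    have "h z = (rt (\<star>) w ^^ k) z" if "z \<in> X" for z
      using automorphisms_eqI[OF hA R w v(1) v(2) _ k that] fix_w rt_funpow_self[OF w] by simp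
    hence "(h ^^ p) v = ((rt (\<star>) w ^^ k) ^^ p) v"
      using automorphisms_closed[OF R] v(1) by (intro funpow_cong_on[of X]) auto
    hence "(rt (\<star>) w ^^ (k * p)) v = v" using hp[OF v(1)] by (simp add: funpow_mult mult.commute)
    hence "card X - 1 dvd k * p" using cycle_length_dvd_iff[OF w v(1)] one_cycle[OF w v] by simp
    moreover have "coprime (card X - 1) p"
    proof (rule coprimeI)
      fix d assume "d dvd card X - 1" "d dvd p"
      hence "d dvd card X" "d dvd card X - 1" using p(2) by auto
      hence "d dvd card X - (card X - 1)" by (rule dvd_diff_nat)
      thus "is_unit d" using card_ge_3 by simp
    qed
    ultimately have "card X - 1 dvd k" by (simp add: coprime_dvd_mult_left_iff)
    hence "h v = id v" using cycle_length_dvd_iff[OF w v(1)] one_cycle[OF w v] k by simp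
    hence "h z = z" if "z \<in> X" for z
      using automorphisms_eqI[OF hA automorphisms_id w v(1) v(2) _ _ that] fix_w by simp
    hence "h = (\<lambda>x\<in>X. x)" using hB by (intro extensionalityI[of h X]) (simp_all add: Bij_def)
    thus False using h(2) by (simp add: G_def BijGroup_def)
  qed
  hence "h \<in> fpf_automorphisms" using hA by (simp add: fpf_automorphisms_def)
  thus ?thesis using hp by blast
qed

text \<open>Two different primes dividing \<open>|X|\<close> would give fixed-point-free automorphisms of different prime
orders, but their orders agree.\<close>

lemma card_prime_power: "\<exists>p a. prime p \<and> a > 0 \<and> card X = p ^ a"
proof -
  obtain z where z: "z \<in> X" using card_ge_3 by fastforce
  obtain p where p: "prime p" "p dvd card X" using card_ge_3 prime_factor_nat[of "card X"] by auto
  have uniq: "r = p" if r: "prime r" "r dvd card X" for r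
  proof (rule ccontr)
    assume "r \<noteq> p"
    hence cop: "coprime r p" using p(1) r(1) primes_coprime by blast
    obtain h where h: "h \<in> fpf_automorphisms" "\<forall>w\<in>X. (h ^^ p) w = w"
      using prime_order_fpf_automorphism[OF p] by auto
    obtain g where g: "g \<in> fpf_automorphisms" "\<forall>w\<in>X. (g ^^ r) w = w"
      using prime_order_fpf_automorphism[OF r] by auto
    have hA: "h \<in> automorphisms X (\<star>)" "h z \<noteq> z" using h(1) z by (auto simp: fpf_automorphisms_def)
    note fixed = funpow_fixed_iff_card_orbit_dvd[OF automorphisms_bij[OF hA(1)] finite z]
    have "(h ^^ r) z = z" using fpf_automorphisms_order[OF g(1) h(1) _ z] g(2) by blast
    hence "card (orbit h z) dvd r" "card (orbit h z) dvd p"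
      using h(2) z fixed by auto
    hence "card (orbit h z) dvd 1" using cop coprime_common_divisor by blast
    thus False using fixed[of 1] hA(2) by simp
  qed
  have "card X \<noteq> 0" "\<not> is_unit p" using card_ge_3 p(1) by auto
  then obtain k where k: "card X = p ^ multiplicity p (card X) * k" "\<not> p dvd k"
    using multiplicity_decompose'[of "card X" p] by metis
  have "k = 1"
  proof (rule ccontr)
    assume "k \<noteq> 1"
    then obtain r where "prime r" "r dvd k" using prime_factor_nat by blast
    thus False using uniq[of r] k by (metis dvd_mult)
  qed
  hence "card X = p ^ multiplicity p (card X)" using k(1) by simp
  moreover have "multiplicity p (card X) > 0"
    using calculation card_ge_3 by (cases "multiplicity p (card X)") auto
  ultimately show ?thesis using p(1) by blast
qed

end

section \<open>Divisibility chains of cycle lengths and blocks\<close>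

text \<open>The combinatorial content of an SHQ, with no reference to lists or labelings. The one-element quandle
is included, so that every nonempty subquandle of a chain quandle is one. The condition \<open>same_cycle\<close>
also contains that a translation has only one fixed point, since \<open>x\<close> itself has length \<open>1\<close>.\<close>

locale chain_quandle = finite_quandle +
  assumes same_cycle: "\<lbrakk>x \<in> X; y \<in> X; z \<in> X; cycle_length (\<star>) x y = cycle_length (\<star>) x z\<rbrakk>
      \<Longrightarrow> z \<in> orbit (rt (\<star>) x) y"
    and chain: "\<lbrakk>x \<in> X; y \<in> X; z \<in> X\<rbrakk>
      \<Longrightarrow> cycle_length (\<star>) x y dvd cycle_length (\<star>) x z \<or> cycle_length (\<star>) x z dvd cycle_length (\<star>) x y"
begin

lemma cycle_length_eq_1_iff:
  assumes "x \<in> X" "y \<in> X"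
  shows "cycle_length (\<star>) x y = 1 \<longleftrightarrow> y = x"
proof
  assume "cycle_length (\<star>) x y = 1"
  hence "y \<in> orbit (rt (\<star>) x) x"
    using same_cycle[OF assms(1) assms(1) assms(2)] cycle_length_self[OF assms(1)] by simp
  thus "y = x" using mem_cycle_iff[OF assms(1,1)] rt_funpow_self[OF assms(1)] by auto
qed (use cycle_length_self assms in simp)

lemma chain_subquandle:
  assumes "finite_quandle Y (\<star>)" "Y \<subseteq> X"
  shows "chain_quandle Y (\<star>)"
proof -
  have "z \<in> orbit (rt (\<star>) x) y"
    if "x \<in> Y" "y \<in> Y" "z \<in> Y" "cycle_length (\<star>) x y = cycle_length (\<star>) x z" for x y z
    using same_cycle[OF _ _ _ that(4)] subsetD[OF assms(2)] that(1-3) by simp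
  moreover have "cycle_length (\<star>) x y dvd cycle_length (\<star>) x z \<or> cycle_length (\<star>) x z dvd cycle_length (\<star>) x y"
    if "x \<in> Y" "y \<in> Y" "z \<in> Y" for x y z
    using chain subsetD[OF assms(2)] that by simp
  ultimately show ?thesis
    using assms(1) by (intro chain_quandle.intro chain_quandle_axioms.intro)
qed

end

text \<open>Every chain quandle turns out to satisfy the extra condition (\<open>chain_quandle_hereditary\<close>). The locale
isolates what follows from it, so that this is available inside the induction that proves it.\<close>

locale hereditary_chain_quandle = chain_quandle +
  assumes sub_indecomposable: "\<lbrakk>finite_quandle Y (\<star>); Y \<subseteq> X\<rbrakk> \<Longrightarrow> indecomposable Y (\<star>)"
begin

lemma indec: "indecomposable X (\<star>)"
  using finite_quandle_axioms order_refl by (rule sub_indecomposable)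

lemma transitive: "x \<in> X \<Longrightarrow> y \<in> X \<Longrightarrow> \<exists>f\<in>automorphisms X (\<star>). f x = y"
  using indecomposable_transitive[OF indec] .

lemma hereditary_subquandle:
  assumes "finite_quandle Y (\<star>)" "Y \<subseteq> X"
  shows "hereditary_chain_quandle Y (\<star>)"
  using chain_subquandle[OF assms] sub_indecomposable[OF _ order_trans[OF _ assms(2)]]
  by (intro hereditary_chain_quandle.intro hereditary_chain_quandle_axioms.intro)

text \<open>The block is connected, so its points see the same cycle lengths within it. Hence the whole block
around \<open>x\<close> lies in the block around \<open>y\<close>, and an automorphism that takes \<open>x\<close> to \<open>y\<close> shows that both have
the same size.\<close>

lemma block_eq:
  assumes x: "x \<in> X" and y: "y \<in> block X (\<star>) x d"
  shows "block X (\<star>) y d = block X (\<star>) x d"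
proof -
  let ?B = "block X (\<star>) x d"
  have yX: "y \<in> X" using y block_subset by auto
  have fq: "finite_quandle ?B (\<star>)" using block_quandle[OF x] .
  have "indecomposable ?B (\<star>)" using fq block_subset by (rule sub_indecomposable)
  hence eq: "cycle_length (\<star>) x ` ?B = cycle_length (\<star>) y ` ?B"
    using finite_quandle.cycle_lengths_eq[OF fq _ self_in_block[OF x] y] by simp
  have sub: "?B \<subseteq> block X (\<star>) y d"
  proof
    fix b assume b: "b \<in> ?B"
    hence "cycle_length (\<star>) y b \<in> cycle_length (\<star>) x ` ?B" unfolding eq by (rule imageI)
    then obtain b' where "b' \<in> ?B" "cycle_length (\<star>) y b = cycle_length (\<star>) x b'" by (elim imageE)
    hence "cycle_length (\<star>) y b dvd d" by (simp add: block_def)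
    thus "b \<in> block X (\<star>) y d" using b by (simp add: block_def)
  qed
  obtain f where f: "f \<in> automorphisms X (\<star>)" "f x = y"
    using transitive[OF x yX] by (elim bexE)
  have "inj_on f ?B"
    using bij_betw_imp_inj_on[OF automorphisms_bij[OF f(1)]] block_subset by (rule inj_on_subset)
  hence "card (f ` ?B) = card ?B" by (rule card_image)
  hence "card ?B = card (block X (\<star>) y d)"
    using block_automorphism_image[OF f(1) x, of d] f(2) by simp
  thus ?thesis
    using card_subset_eq[OF finite_subset[OF block_subset finite] sub] by simp
qed

lemma block_eq_iff:
  assumes "x \<in> X" "y \<in> X"
  shows "block X (\<star>) x d = block X (\<star>) y d \<longleftrightarrow> cycle_length (\<star>) x y dvd d"
proof
  assume "block X (\<star>) x d = block X (\<star>) y d"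
  hence "y \<in> block X (\<star>) x d" using self_in_block[OF assms(2)] by simp
  thus "cycle_length (\<star>) x y dvd d" by (simp add: block_def)
next
  assume "cycle_length (\<star>) x y dvd d"
  hence "y \<in> block X (\<star>) x d" using assms by (simp add: block_def)
  thus "block X (\<star>) x d = block X (\<star>) y d" using block_eq[OF assms(1)] by simp
qed

lemma cycle_length_sym:
  assumes "x \<in> X" "y \<in> X"
  shows "cycle_length (\<star>) x y = cycle_length (\<star>) y x"
  using block_eq_iff[OF assms, of "cycle_length (\<star>) x y"] block_eq_iff[OF assms(2,1), of "cycle_length (\<star>) x y"]
    block_eq_iff[OF assms, of "cycle_length (\<star>) y x"] block_eq_iff[OF assms(2,1), of "cycle_length (\<star>) y x"]
  by (intro dvd_antisym) simp_all

text \<open>The blocks for a fixed \<open>d\<close> are the classes of an equivalence relation.\<close>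

lemma ultrametric:
  assumes "x \<in> X" "y \<in> X" "z \<in> X" "cycle_length (\<star>) x y dvd d" "cycle_length (\<star>) y z dvd d"
  shows "cycle_length (\<star>) x z dvd d"
  using block_eq_iff[OF assms(1,2), of d] block_eq_iff[OF assms(2,3), of d]
    block_eq_iff[OF assms(1,3), of d] assms(4,5) by simp

end

locale least_length = hereditary_chain_quandle +
  fixes l :: nat
  assumes l_attained: "x \<in> X \<Longrightarrow> \<exists>y\<in>X. cycle_length (\<star>) x y = l"
    and l_gt_1: "l > 1"
    and l_dvd: "\<lbrakk>x \<in> X; y \<in> X; y \<noteq> x\<rbrakk> \<Longrightarrow> l dvd cycle_length (\<star>) x y"
begin

lemma block_structure:
  assumes x: "x \<in> X" and y: "y \<in> X" "cycle_length (\<star>) x y = l"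
  shows "block X (\<star>) x l = insert x (orbit (rt (\<star>) x) y)"
proof (intro equalityI subsetI)
  fix z assume z: "z \<in> block X (\<star>) x l"
  hence zX: "z \<in> X" by (simp add: block_def)
  show "z \<in> insert x (orbit (rt (\<star>) x) y)"
  proof (cases "z = x")
    case False
    hence "cycle_length (\<star>) x z = l"
      using l_dvd[OF x zX False] z by (auto simp: block_def intro: dvd_antisym)
    thus ?thesis using same_cycle[OF x y(1) zX] y(2) by simp
  qed simp
next
  fix z assume "z \<in> insert x (orbit (rt (\<star>) x) y)"
  thus "z \<in> block X (\<star>) x l"
  proof
    assume "z = x" thus ?thesis using self_in_block x by simp
  next
    assume z: "z \<in> orbit (rt (\<star>) x) y"
    hence "cycle_length (\<star>) x z = l" using cycle_length_of_mem[OF x y(1)] y(2) by simp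
    thus ?thesis using z cycle_subset[OF x y(1)] by (auto simp: block_def)
  qed
qed

lemma card_block:
  assumes x: "x \<in> X"
  shows "card (block X (\<star>) x l) = l + 1"
proof -
  obtain y where y: "y \<in> X" "cycle_length (\<star>) x y = l" using l_attained[OF x] by auto
  have "x \<notin> orbit (rt (\<star>) x) y"
    using cycle_length_of_mem[OF x y(1), of x] cycle_length_self[OF x] y(2) l_gt_1 by auto
  moreover have "finite (orbit (rt (\<star>) x) y)" using cycle_subset[OF x y(1)] finite by (rule finite_subset)
  ultimately show ?thesis
    using y(2) unfolding block_structure[OF x y] by (simp add: cycle_length_def)
qed

text \<open>By the ultrametric inequality, moving within a smallest block changes the distance \<open>\<lambda>\<close> to \<open>x\<close> only if \<open>x\<close> is in that
block.\<close>

lemma cycle_length_block_mate: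
  assumes x: "x \<in> X" and w: "w \<in> X" "w \<notin> block X (\<star>) x l" and u: "u \<in> block X (\<star>) w l"
  shows "cycle_length (\<star>) x u = cycle_length (\<star>) x w"
proof -
  have uX: "u \<in> X" and wu: "cycle_length (\<star>) w u dvd l" using u by (auto simp: block_def)
  have "w \<noteq> x" using w self_in_block x by auto
  hence 1: "l dvd cycle_length (\<star>) x w" using l_dvd x w by auto
  have "u \<noteq> x" using wu w cycle_length_sym[OF x w(1)] by (auto simp: block_def)
  hence 2: "l dvd cycle_length (\<star>) x u" using l_dvd x uX by auto
  have uw: "cycle_length (\<star>) u w dvd l" using wu cycle_length_sym[OF uX w(1)] by simp
  show ?thesis
    using ultrametric[OF x w(1) uX dvd_refl dvd_trans[OF wu 1]]
      ultrametric[OF x uX w(1) dvd_refl dvd_trans[OF uw 2]] by (rule dvd_antisym)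
qed

lemma block_subset_cycle:
  assumes x: "x \<in> X" and w: "w \<in> X" "w \<notin> block X (\<star>) x l"
  shows "block X (\<star>) w l \<subseteq> orbit (rt (\<star>) x) w"
proof
  fix u assume u: "u \<in> block X (\<star>) w l"
  hence "u \<in> X" by (simp add: block_def)
  thus "u \<in> orbit (rt (\<star>) x) w"
    using same_cycle[OF x w(1)] cycle_length_block_mate[OF x w u] by simp
qed

text \<open>A chosen element in each of the smallest blocks. Modelling the quotient on representatives keeps it in
the type \<open>'a\<close>, as the induction on the cardinality requires.\<close>

definition rep :: "'a \<Rightarrow> 'a" where
  "rep y = (SOME z. z \<in> block X (\<star>) y l)"

lemma rep_in_block: "y \<in> X \<Longrightarrow> rep y \<in> block X (\<star>) y l"
  unfolding rep_def using self_in_block[of y l] by (rule someI)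

lemma rep_closed: "y \<in> X \<Longrightarrow> rep y \<in> X"
  using rep_in_block block_subset by (rule subsetD[rotated])

lemma rep_eq_iff:
  assumes "y \<in> X" "z \<in> X"
  shows "rep y = rep z \<longleftrightarrow> z \<in> block X (\<star>) y l"
proof
  assume eq: "rep y = rep z"
  have "block X (\<star>) z l = block X (\<star>) (rep z) l"
    using block_eq[OF assms(2) rep_in_block[OF assms(2)]] by simp
  also have "\<dots> = block X (\<star>) y l"
    using block_eq[OF assms(1) rep_in_block[OF assms(1)]] eq by simp
  finally show "z \<in> block X (\<star>) y l" using self_in_block[OF assms(2), of l] by simp
next
  assume "z \<in> block X (\<star>) y l"
  thus "rep y = rep z" using block_eq[OF assms(1)] unfolding rep_def by simp
qed

lemma rep_rep: "y \<in> X \<Longrightarrow> rep (rep y) = rep y"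
  using rep_eq_iff[of y "rep y"] rep_closed[of y] rep_in_block[of y] by simp

lemma rep_cong:
  assumes f: "f \<in> automorphisms X (\<star>)" and "y \<in> X" "z \<in> X" "rep y = rep z"
  shows "rep (f y) = rep (f z)"
proof -
  have "f z \<in> f ` block X (\<star>) y l" using assms rep_eq_iff by auto
  hence "f z \<in> block X (\<star>) (f y) l" using block_automorphism_image[OF f assms(2)] by simp
  thus ?thesis using rep_eq_iff automorphisms_closed[OF f] assms(2,3) by simp
qed

lemma cycle_of_blocks:
  assumes x: "x \<in> X" and w: "w \<in> X" "w \<notin> block X (\<star>) x l"
  shows "cycle_length (\<star>) x w = (l + 1) * card (orbit (rep \<circ> rt (\<star>) x) (rep w))"
    and "rep ((rt (\<star>) x ^^ k) w) = rep w \<longleftrightarrow> card (orbit (rep \<circ> rt (\<star>) x) (rep w)) dvd k"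
proof -
  have fib: "card {u \<in> orbit (rt (\<star>) x) w. rep u = rep v} = l + 1"
    if v: "v \<in> orbit (rt (\<star>) x) w" for v
  proof -
    have vX: "v \<in> X" using v cycle_subset[OF x w(1)] by auto
    have eq: "cycle_length (\<star>) x v = cycle_length (\<star>) x w" by (rule cycle_length_of_mem[OF x w(1) v])
    hence v': "v \<notin> block X (\<star>) x l" using w by (simp add: block_def)
    have "orbit (rt (\<star>) x) v = orbit (rt (\<star>) x) w"
      by (rule orbit_eq_of_mem[OF rt_bij[OF x] finite w(1) v])
    hence sub: "block X (\<star>) v l \<subseteq> orbit (rt (\<star>) x) w" using block_subset_cycle[OF x vX v'] by simp
    have "u \<in> block X (\<star>) v l \<longleftrightarrow> rep u = rep v" if "u \<in> orbit (rt (\<star>) x) w" for u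
      using rep_eq_iff[OF vX, of u] subsetD[OF cycle_subset[OF x w(1)] that] by auto
    hence "{u \<in> orbit (rt (\<star>) x) w. rep u = rep v} = block X (\<star>) v l"
      using sub by blast
    thus ?thesis using card_block[OF vX] by simp
  qed
  note * = rt_bij[OF x] finite rep_closed rep_rep rep_cong[OF rt_automorphism[OF x]] w(1) fib
  show "cycle_length (\<star>) x w = (l + 1) * card (orbit (rep \<circ> rt (\<star>) x) (rep w))"
    unfolding cycle_length_def by (rule orbit_of_reps(1)[OF *])
  show "rep ((rt (\<star>) x ^^ k) w) = rep w \<longleftrightarrow> card (orbit (rep \<circ> rt (\<star>) x) (rep w)) dvd k"
    by (rule orbit_of_reps(2)[OF *])
qed

lemma rep_funpow_fixed_iff:
  assumes x: "x \<in> X" and w: "w \<in> X" "w \<notin> block X (\<star>) x l"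
  shows "rep ((rt (\<star>) x ^^ k) w) = rep w \<longleftrightarrow> cycle_length (\<star>) x w dvd (l + 1) * k"
  unfolding cycle_of_blocks(1)[OF assms] cycle_of_blocks(2)[OF assms] by (simp only: nat_mult_dvd_cancel_disj) simp

lemma Suc_l_dvd:
  assumes x: "x \<in> X" and w: "w \<in> X" "w \<notin> block X (\<star>) x l"
  shows "l + 1 dvd cycle_length (\<star>) x w"
  unfolding cycle_of_blocks(1)[OF assms] by (rule dvd_triv_left)

end

section \<open>The quotient by the smallest blocks\<close>

context finite_quandle begin

lemma rt_power_fixed_iff:
  assumes "x \<in> X" "y \<in> X"
  shows "((rt (\<star>) x ^^ m) ^^ j) y = y \<longleftrightarrow> cycle_length (\<star>) x y dvd m * j"
  using cycle_length_dvd_iff[OF assms] by (simp add: funpow_mult mult.commute)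

end

context chain_quandle begin

lemma longest_cycle:
  assumes x: "x \<in> X"
  shows "\<exists>z\<in>X. \<forall>w\<in>X. cycle_length (\<star>) x w dvd cycle_length (\<star>) x z"
proof -
  let ?M = "Max (cycle_length (\<star>) x ` X)"
  have "?M \<in> cycle_length (\<star>) x ` X" using x finite by (intro Max_in) auto
  then obtain z where z: "z \<in> X" "?M = cycle_length (\<star>) x z" by (elim imageE)
  have "cycle_length (\<star>) x w dvd cycle_length (\<star>) x z" if w: "w \<in> X" for w
  proof -
    have le: "cycle_length (\<star>) x w \<le> cycle_length (\<star>) x z"
      unfolding z(2)[symmetric] using w finite by simp
    show ?thesis using chain[OF x w z(1)]
    proof
      assume "cycle_length (\<star>) x z dvd cycle_length (\<star>) x w"
      thus ?thesis using le cycle_length_pos[OF x w] dvd_imp_le by fastforce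
    qed
  qed
  thus ?thesis using z(1) by blast
qed

end

context least_length begin

text \<open>The \<open>m\<close>-th power of \<open>R\<^sub>x\<close> maps the block of \<open>w\<close> to itself, and the first return to \<open>w\<close> happens after
\<open>l + 1\<close> steps; so it permutes that block in a single cycle.\<close>

lemma block_reached_by_power:
  assumes x: "x \<in> X" and w: "w \<in> X" "cycle_length (\<star>) x w = (l + 1) * m" "w \<notin> block X (\<star>) x l"
    and u: "u \<in> block X (\<star>) w l"
  shows "\<exists>j. u = ((rt (\<star>) x ^^ m) ^^ j) w"
proof -
  let ?T = "rt (\<star>) x ^^ m" and ?Z = "block X (\<star>) w l"
  have T: "?T \<in> automorphisms X (\<star>)" using automorphisms_funpow[OF rt_automorphism[OF x]] .
  have m: "m > 0" using cycle_length_pos[OF x w(1)] w(2) by (auto intro: Nat.gr0I)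
  have "rep (?T w) = rep w" using rep_funpow_fixed_iff[OF x w(1,3)] w(2) by simp
  hence "w \<in> block X (\<star>) (?T w) l" using rep_eq_iff automorphisms_closed[OF T] w(1) by simp
  hence "block X (\<star>) (?T w) l = ?Z" using block_eq automorphisms_closed[OF T] w(1) by metis
  hence "?T ` ?Z = ?Z" using block_automorphism_image[OF T w(1)] by simp
  hence bij: "bij_betw ?T ?Z ?Z"
    using bij_betw_subset[OF automorphisms_bij[OF T] block_subset] by blast
  have "(?T ^^ j) w = w \<longleftrightarrow> card ?Z dvd j" for j
    using rt_power_fixed_iff[OF x w(1), of j m]
    unfolding w(2) card_block[OF w(1)] mult_dvd_cancel_middle[OF m] .
  hence "orbit ?T w = ?Z"
    using bij finite_subset[OF block_subset finite] self_in_block[OF w(1)]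
    by (intro orbit_eq_of_full_period) auto
  thus ?thesis
    using u mem_orbit_iff_funpow[OF bij finite_subset[OF block_subset finite] self_in_block[OF w(1)], of u]
    by simp
qed

lemma cycle_lengths_all_eq: "x \<in> X \<Longrightarrow> y \<in> X \<Longrightarrow> cycle_length (\<star>) x ` X = cycle_length (\<star>) y ` X"
  by (rule cycle_lengths_eq[OF indec])

text \<open>Let \<open>z\<close> lie on the longest cycle of \<open>R\<^sub>x\<close>, of length \<open>e = (l + 1) m\<close>, and let \<open>T\<close> be the \<open>m\<close>-th power of
\<open>R\<^sub>z\<close>. All lengths divide \<open>e\<close>, so \<open>T\<close> maps every smallest block to itself; and it permutes the block of
\<open>x\<close> in a single cycle. So some power of \<open>T\<close> takes \<open>x\<close> to \<open>x'\<close>, and conjugation by it turns \<open>R\<^sub>x\<close> into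
the translation by \<open>x'\<close> without changing the induced action on the blocks.\<close>

lemma translations_agree_on_blocks:
  assumes nontriv: "z0 \<in> X" "z0 \<notin> block X (\<star>) x l"
    and x: "x \<in> X" and x': "x' \<in> block X (\<star>) x l" and y: "y \<in> X"
  shows "rep (y \<star> x) = rep (y \<star> x')"
proof -
  obtain z where z: "z \<in> X" "\<And>w. w \<in> X \<Longrightarrow> cycle_length (\<star>) x w dvd cycle_length (\<star>) x z"
    using longest_cycle[OF x] by auto
  define e where "e = cycle_length (\<star>) x z"
  \<comment> \<open>The length at \<open>z\<^sub>0\<close> does not divide \<open>l\<close>, hence neither does its multiple \<open>e\<close>.\<close>
  have "\<not> e dvd l" using z(2)[OF nontriv(1)] nontriv dvd_trans unfolding e_def block_def by blast
  have zx: "cycle_length (\<star>) z x = e" unfolding e_def by (rule cycle_length_sym[OF z(1) x])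
  hence xz: "x \<notin> block X (\<star>) z l" using \<open>\<not> e dvd l\<close> by (simp add: block_def)
  have dvd_e: "cycle_length (\<star>) z w dvd e" if "w \<in> X" for w
  proof -
    have "cycle_length (\<star>) z w \<in> cycle_length (\<star>) x ` X"
      unfolding cycle_lengths_all_eq[OF x z(1)] using that by (rule imageI)
    thus ?thesis using z(2) unfolding e_def by (elim imageE) simp
  qed
  obtain m where m: "e = (l + 1) * m" using Suc_l_dvd[OF z(1) x xz] unfolding zx by (elim dvdE)
  let ?T = "rt (\<star>) z ^^ m"
  have T: "?T \<in> automorphisms X (\<star>)" using automorphisms_funpow[OF rt_automorphism[OF z(1)]] .
  have T_rep: "rep (?T w) = rep w" if w: "w \<in> X" for w
  proof (cases "w \<in> block X (\<star>) z l")
    case False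
    thus ?thesis using rep_funpow_fixed_iff[OF z(1) w] dvd_e[OF w] m by simp
  next
    case True
    have "?T w \<in> block X (\<star>) z l"
      using cycle_length_automorphism[OF T z(1) w] rt_funpow_self[OF z(1)]
        True automorphisms_closed[OF T w] by (simp add: block_def)
    thus ?thesis using True rep_eq_iff[OF z(1)] w automorphisms_closed[OF T w] by metis
  qed
  obtain j where j: "x' = (?T ^^ j) x"
    using block_reached_by_power[OF z(1) x _ xz x'] zx m by auto
  let ?g = "?T ^^ j"
  have g: "?g \<in> automorphisms X (\<star>)" using automorphisms_funpow[OF T] .
  have g_rep: "rep (?g w) = rep w" if w: "w \<in> X" for w
  proof (induction j)
    case (Suc j)
    thus ?case using T_rep[OF automorphisms_closed[OF automorphisms_funpow[OF T] w, of j]] by simp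
  qed simp
  obtain y0 where y0: "y0 \<in> X" "?g y0 = y" using automorphisms_surj[OF g y] by auto
  have "rep (y \<star> x') = rep (?g (y0 \<star> x))"
    unfolding j using automorphisms_hom[OF g y0(1) x] y0(2) by simp
  also have "\<dots> = rep (y0 \<star> x)" using g_rep closed y0(1) x by simp
  also have "\<dots> = rep (?g y0 \<star> x)"
    using rep_cong[OF rt_automorphism[OF x], of y0 "?g y0"] g_rep[OF y0(1)] y0 y by simp
  finally show ?thesis using y0(2) by simp
qed

lemma finite_block: "finite (block X (\<star>) x d)"
  using finite_subset[OF block_subset finite] .

lemma card_eq_card_reps: "card X = (l + 1) * card (rep ` X)"
proof (rule card_partition_by_map[OF finite])
  fix w assume w: "w \<in> X"
  have "u \<in> block X (\<star>) w l \<longleftrightarrow> rep u = rep w" if "u \<in> X" for u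
    using rep_eq_iff[OF w that] by auto
  hence "{u \<in> X. rep u = rep w} = block X (\<star>) w l"
    using block_subset[of w l] by blast
  thus "card {u \<in> X. rep u = rep w} = l + 1" using card_block[OF w] by simp
qed

definition quotient_op :: "'a \<Rightarrow> 'a \<Rightarrow> 'a" where
  "quotient_op u v = rep (u \<star> v)"

text \<open>Outside the block of \<open>x\<close> a cycle of \<open>R\<^sub>x\<close> is a union of smallest blocks, so its length is divided by
\<open>l + 1\<close> in the quotient. No such length becomes \<open>1\<close>, because \<open>l\<close> does not divide \<open>l + 1\<close>; therefore
distinctness of the lengths survives.\<close>

lemma quotient_chain_quandle:
  assumes nontriv: "\<And>x. x \<in> X \<Longrightarrow> \<exists>z\<in>X. z \<notin> block X (\<star>) x l"
  shows "chain_quandle (rep ` X) quotient_op"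
    and "\<lbrakk>x \<in> rep ` X; y \<in> rep ` X; y \<noteq> x\<rbrakk> \<Longrightarrow>
      cycle_length (\<star>) x y = (l + 1) * cycle_length quotient_op x y \<and> y \<notin> block X (\<star>) x l"
proof -
  have reps: "u \<in> X" "rep u = u" if "u \<in> rep ` X" for u
    using that rep_closed rep_rep by auto
  have rep_left: "rep (rep u \<star> v) = rep (u \<star> v)" if "u \<in> X" "v \<in> X" for u v
    using rep_cong[OF rt_automorphism[OF that(2)], of "rep u" u] that(1) rep_closed rep_rep by simp
  have rep_right: "rep (u \<star> rep v) = rep (u \<star> v)" if u: "u \<in> X" and v: "v \<in> X" for u v
  proof -
    obtain z where "z \<in> X" "z \<notin> block X (\<star>) v l" using nontriv[OF v] by auto
    from translations_agree_on_blocks[OF this v rep_in_block[OF v] u] show ?thesis by simp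
  qed
  have rt_eq: "rt quotient_op x = rep \<circ> rt (\<star>) x" for x
    by (simp add: quotient_op_def fun_eq_iff)
  have bij: "bij_betw (rt quotient_op x) (rep ` X) (rep ` X)" if "x \<in> X" for x
    unfolding rt_eq
    by (rule reps_bij[OF rt_bij[OF that] finite rep_closed rep_rep rep_cong[OF rt_automorphism[OF that]]])
  have q: "finite_quandle (rep ` X) quotient_op"
  proof (intro finite_quandle.intro quandle.intro finite_quandle_axioms.intro)
    fix i j assume i: "i \<in> rep ` X" and j: "j \<in> rep ` X"
    show "quotient_op i j \<in> rep ` X"
      unfolding quotient_op_def by (intro imageI closed reps(1) i j)
    note b = bij[OF reps(1)[OF j]]
    show "\<exists>!x. x \<in> rep ` X \<and> quotient_op x j = i"
    proof (rule ex1I)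
      show "inv_into (rep ` X) (rt quotient_op j) i \<in> rep ` X \<and>
          quotient_op (inv_into (rep ` X) (rt quotient_op j) i) j = i"
        using bij_betw_apply[OF bij_betw_inv_into[OF b] i] bij_betw_inv_into_right[OF b i] by (rule conjI)
    next
      fix x assume "x \<in> rep ` X \<and> quotient_op x j = i"
      thus "x = inv_into (rep ` X) (rt quotient_op j) i"
        using bij_betw_inv_into_left[OF b, of x] by (elim conjE) simp
    qed
    fix k assume k: "k \<in> rep ` X"
    have "quotient_op (quotient_op i j) k = rep ((i \<star> j) \<star> k)"
      unfolding quotient_op_def
      by (rule rep_left[OF closed, OF reps(1)[OF i] reps(1)[OF j] reps(1)[OF k]])
    also have "\<dots> = rep ((i \<star> k) \<star> (j \<star> k))"
      unfolding right_distrib[OF reps(1)[OF i] reps(1)[OF j] reps(1)[OF k]] ..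
    also have "\<dots> = rep (rep (i \<star> k) \<star> rep (j \<star> k))"
      unfolding rep_left[OF closed rep_closed[OF closed], OF reps(1)[OF i] reps(1)[OF k] reps(1)[OF j] reps(1)[OF k]]
        rep_right[OF closed closed, OF reps(1)[OF i] reps(1)[OF k] reps(1)[OF j] reps(1)[OF k]] ..
    finally show "quotient_op (quotient_op i j) k = quotient_op (quotient_op i k) (quotient_op j k)"
      unfolding quotient_op_def .
  next
    fix i assume "i \<in> rep ` X"
    thus "quotient_op i i = i" unfolding quotient_op_def using reps[of i] idem[of i] by simp
  qed (use finite in simp)
  interpret Q: finite_quandle "rep ` X" quotient_op by (rule q)
  have outside: "y \<notin> block X (\<star>) x l" if "x \<in> rep ` X" "y \<in> rep ` X" "y \<noteq> x" for x y
    using rep_eq_iff[OF reps(1)[OF that(1)] reps(1)[OF that(2)]] reps(2)[OF that(1)] reps(2)[OF that(2)] that(3)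
    by auto
  have len: "cycle_length (\<star>) x y = (l + 1) * cycle_length quotient_op x y"
    if "x \<in> rep ` X" "y \<in> rep ` X" "y \<noteq> x" for x y
    using cycle_of_blocks(1)[OF reps(1)[OF that(1)] reps(1)[OF that(2)] outside[OF that]] reps(2)[OF that(2)]
    unfolding cycle_length_def[of quotient_op] rt_eq by simp
  show "\<lbrakk>x \<in> rep ` X; y \<in> rep ` X; y \<noteq> x\<rbrakk> \<Longrightarrow>
      cycle_length (\<star>) x y = (l + 1) * cycle_length quotient_op x y \<and> y \<notin> block X (\<star>) x l"
    using len outside by blast
  have len1: "cycle_length quotient_op x y = 1 \<longleftrightarrow> y = x" if x: "x \<in> rep ` X" and y: "y \<in> rep ` X" for x y
  proof
    assume 1: "cycle_length quotient_op x y = 1"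
    show "y = x"
    proof (rule ccontr)
      assume "y \<noteq> x"
      hence "cycle_length (\<star>) x y = l + 1" "l dvd cycle_length (\<star>) x y"
        using len[OF x y] 1 l_dvd[OF reps(1)[OF x] reps(1)[OF y]] by simp_all
      hence "l dvd 1" by (metis dvd_add_right_iff dvd_refl)
      thus False using l_gt_1 by simp
    qed
  qed (use Q.cycle_length_self[OF x] in simp)
  show "chain_quandle (rep ` X) quotient_op"
  proof (intro chain_quandle.intro chain_quandle_axioms.intro q)
    fix x y z assume x: "x \<in> rep ` X" and y: "y \<in> rep ` X" and z: "z \<in> rep ` X"
    show "cycle_length quotient_op x y dvd cycle_length quotient_op x z \<or>
      cycle_length quotient_op x z dvd cycle_length quotient_op x y"
    proof (cases "y = x \<or> z = x")
      case True thus ?thesis using Q.cycle_length_self[OF x] by auto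
    next
      case False
      hence "(l + 1) * cycle_length quotient_op x y dvd (l + 1) * cycle_length quotient_op x z \<or>
        (l + 1) * cycle_length quotient_op x z dvd (l + 1) * cycle_length quotient_op x y"
        using chain[OF reps(1)[OF x] reps(1)[OF y] reps(1)[OF z]] len[OF x y] len[OF x z] by simp
      thus ?thesis by (simp only: nat_mult_dvd_cancel_disj) simp
    qed
    assume eq: "cycle_length quotient_op x y = cycle_length quotient_op x z"
    show "z \<in> orbit (rt quotient_op x) y"
    proof (cases "y = x \<or> z = x")
      case True
      hence "z = y" using eq len1[OF x y] len1[OF x z] Q.cycle_length_self[OF x] by auto
      thus ?thesis using Q.self_in_cycle[OF x y] by simp
    next
      case False
      hence "cycle_length (\<star>) x y = cycle_length (\<star>) x z" using len[OF x y] len[OF x z] eq by simp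
      hence "z \<in> orbit (rt (\<star>) x) y" using same_cycle reps(1) x y z by simp
      then obtain k where k: "z = (rt (\<star>) x ^^ k) y"
        using mem_cycle_iff[OF reps(1)[OF x] reps(1)[OF y]] by auto
      have "(rt quotient_op x ^^ k) (rep y) = rep ((rt (\<star>) x ^^ k) y)"
        unfolding rt_eq
        using reps_funpow[OF closed[OF _ reps(1)[OF x]] rep_closed rep_rep
            rep_cong[OF rt_automorphism[OF reps(1)[OF x]]] reps(1)[OF y]] .
      hence "z = (rt quotient_op x ^^ k) y" using reps(2)[OF y] reps(2)[OF z] k by simp
      thus ?thesis using Q.mem_cycle_iff[OF x y] by auto
    qed
  qed
qed

section \<open>Quandles with three cycle lengths\<close>

text \<open>Let \<open>T\<^sub>x\<close> be the \<open>m\<close>-th power of \<open>R\<^sub>x\<close>. As \<open>l\<close> divides \<open>m\<close>, it fixes the block of \<open>x\<close> pointwise, and it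
permutes each other block in a full cycle. Fix two blocks, of \<open>x\<^sub>0\<close> and of \<open>z\<^sub>0\<close>, and a point \<open>x\<^sub>1 \<noteq> x\<^sub>0\<close> in the
former. For each \<open>w\<close> in a third block some power \<open>V w\<close> of \<open>T\<^sub>w\<close> takes \<open>x\<^sub>0\<close> to \<open>x\<^sub>1\<close>. An automorphism is
determined by the images of \<open>x\<^sub>0\<close> and \<open>z\<^sub>0\<close>, and the fixed points of \<open>V w\<close> are the block of \<open>w\<close>; hence
different blocks give different points \<open>V w z\<^sub>0\<close>, all of them among the \<open>l\<close> points other than \<open>z\<^sub>0\<close> in
its block. There are \<open>m + 1\<close> blocks, so \<open>m - 1 \<le> l\<close>, and \<open>l dvd m\<close> leaves only \<open>m = l\<close>.\<close>

lemma three_lengths: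
  assumes lens: "\<And>x w. \<lbrakk>x \<in> X; w \<in> X\<rbrakk> \<Longrightarrow> cycle_length (\<star>) x w \<in> {1, l, (l + 1) * m}"
    and x0: "x0 \<in> X" and z0: "z0 \<in> X" "z0 \<notin> block X (\<star>) x0 l"
  shows "m = l"
proof -
  let ?e = "(l + 1) * m"
  have len_e: "cycle_length (\<star>) x w = ?e" if "x \<in> X" "w \<in> X" "w \<notin> block X (\<star>) x l" for x w
    using lens[OF that(1,2)] that(2,3) by (auto simp: block_def)
  have out_sym: "x \<notin> block X (\<star>) w l" if "x \<in> X" "w \<in> X" "w \<notin> block X (\<star>) x l" for x w
    using that cycle_length_sym[OF that(1,2)] by (simp add: block_def)
  have m: "m > 0" using cycle_length_pos[OF x0 z0(1)] len_e[OF x0 z0] by (auto intro: Nat.gr0I)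
  have "z0 \<noteq> x0" using z0 self_in_block[OF x0] by auto
  hence "l dvd (l + 1) * m" using l_dvd[OF x0 z0(1)] len_e[OF x0 z0] by simp
  \<comment> \<open>\<open>l\<close> divides \<open>(l + 1) m = m + l m\<close>.\<close>
  hence l_m: "l dvd m" using dvd_add_left_iff[of l "l * m" m] by simp
  define T where "T x = rt (\<star>) x ^^ m" for x
  have T: "T x \<in> automorphisms X (\<star>)" if "x \<in> X" for x
    unfolding T_def using automorphisms_funpow[OF rt_automorphism[OF that]] .
  have T_in: "T x u = u" if "x \<in> X" "u \<in> block X (\<star>) x l" for x u
  proof -
    have "u \<in> X" "cycle_length (\<star>) x u dvd m" using that l_m by (auto simp: block_def)
    thus ?thesis using cycle_length_dvd_iff that(1) by (simp add: T_def)
  qed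
  have T_out: "(T x ^^ j) w = w \<longleftrightarrow> l + 1 dvd j" if "x \<in> X" "w \<in> X" "w \<notin> block X (\<star>) x l" for x w j
    using rt_power_fixed_iff[OF that(1,2), of j m]
    unfolding len_e[OF that] T_def mult_dvd_cancel_middle[OF m] .
  have T_rep: "rep (T x w) = rep w" if "x \<in> X" "w \<in> X" for x w
  proof (cases "w \<in> block X (\<star>) x l")
    case True thus ?thesis using T_in[OF that(1)] by simp
  next
    case False
    thus ?thesis using rep_funpow_fixed_iff[OF that False] len_e[OF that False] by (simp add: T_def)
  qed
  have "card (block X (\<star>) x0 l - {x0}) > 0"
    using card_block[OF x0] self_in_block[OF x0, of l] l_gt_1 finite_block by simp
  then obtain x1 where x1: "x1 \<in> block X (\<star>) x0 l" "x1 \<noteq> x0" by (auto simp: card_gt_0_iff)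
  have "\<exists>k. (T w ^^ k) x0 = x1" if "w \<in> X" "w \<notin> block X (\<star>) x0 l" for w
    using block_reached_by_power[OF that(1) x0 _ out_sym[OF x0 that] x1(1)]
      len_e[OF that(1) x0 out_sym[OF x0 that]] unfolding T_def by metis
  then obtain k where k: "\<And>w. \<lbrakk>w \<in> X; w \<notin> block X (\<star>) x0 l\<rbrakk> \<Longrightarrow> (T w ^^ k w) x0 = x1" by metis
  define V where "V w = T w ^^ k w" for w
  have V: "V w \<in> automorphisms X (\<star>)" if "w \<in> X" for w
    unfolding V_def using automorphisms_funpow[OF T[OF that]] .
  have V_out: "V w v \<noteq> v"
    if w: "w \<in> X" "w \<notin> block X (\<star>) x0 l" and v: "v \<in> X" "v \<notin> block X (\<star>) w l" for v w
  proof -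
    have "\<not> l + 1 dvd k w" using T_out[OF w(1) x0 out_sym[OF x0 w], of "k w"] k[OF w] x1(2) by simp
    thus ?thesis using T_out[OF w(1) v, of "k w"] unfolding V_def by simp
  qed
  have V_in: "V w w = w" if "w \<in> X" for w
  proof -
    have "(T w ^^ j) w = w" for j by (induction j) (simp_all add: T_in[OF that self_in_block[OF that]])
    thus ?thesis unfolding V_def .
  qed
  have V_rep: "rep (V w v) = rep v" if "w \<in> X" "v \<in> X" for v w
  proof -
    have "rep ((T w ^^ j) v) = rep v" for j
    proof (induction j)
      case (Suc j)
      thus ?case
        using T_rep[OF that(1) automorphisms_closed[OF automorphisms_funpow[OF T[OF that(1)]] that(2)], of j]
        by simp
    qed simp
    thus ?thesis unfolding V_def .
  qed
  define S where "S = rep ` X - {rep x0, rep z0}"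
  have S: "w \<in> X" "rep w = w" "w \<notin> block X (\<star>) x0 l" "w \<notin> block X (\<star>) z0 l" if "w \<in> S" for w
  proof -
    show 1: "w \<in> X" "rep w = w" using that rep_closed rep_rep unfolding S_def by auto
    show "w \<notin> block X (\<star>) x0 l" "w \<notin> block X (\<star>) z0 l"
      using rep_eq_iff[OF x0 1(1)] rep_eq_iff[OF z0(1) 1(1)] 1(2) that unfolding S_def by auto
  qed
  have "inj_on (\<lambda>w. V w z0) S"
  proof (rule inj_onI)
    fix w w' assume w: "w \<in> S" and w': "w' \<in> S" and eq: "V w z0 = V w' z0"
    have eq0: "V w x0 = V w' x0" unfolding V_def using k S w w' by simp
    have "V w v = V w' v" if v: "v \<in> X" for v
    proof (cases "v \<in> block X (\<star>) x0 l")
      case True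
      hence "v \<in> orbit (rt (\<star>) z0) x0"
        using block_subset_cycle[OF z0(1) x0 out_sym[OF x0 z0]] by auto
      thus ?thesis
        using automorphisms_agree_on_cycle[OF V[OF S(1)[OF w]] V[OF S(1)[OF w']] z0(1) x0 eq eq0] by simp
    next
      case False
      hence "v \<in> orbit (rt (\<star>) x0) z0"
        using len_e[OF x0 z0] len_e[OF x0 v False] by (intro same_cycle[OF x0 z0(1) v]) simp
      thus ?thesis
        using automorphisms_agree_on_cycle[OF V[OF S(1)[OF w]] V[OF S(1)[OF w']] x0 z0(1) eq0 eq] by simp
    qed
    hence "V w' w = w" using V_in[OF S(1)[OF w]] S(1)[OF w] by simp
    hence "w \<in> block X (\<star>) w' l" using V_out[OF S(1)[OF w'] S(3)[OF w'] S(1)[OF w]] by auto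
    thus "w = w'" using rep_eq_iff[OF S(1)[OF w'] S(1)[OF w]] S(2)[OF w] S(2)[OF w'] by simp
  qed
  moreover have "(\<lambda>w. V w z0) ` S \<subseteq> block X (\<star>) z0 l - {z0}"
  proof
    fix v assume "v \<in> (\<lambda>w. V w z0) ` S"
    then obtain w where w: "w \<in> S" "v = V w z0" by (elim imageE)
    have "v \<noteq> z0"
      using V_out[OF S(1)[OF w(1)] S(3)[OF w(1)] z0(1) out_sym[OF z0(1) S(1)[OF w(1)] S(4)[OF w(1)]]] w(2)
      by simp
    moreover have "v \<in> block X (\<star>) z0 l"
      using V_rep[OF S(1)[OF w(1)] z0(1)] rep_eq_iff[OF z0(1), of "V w z0"]
        automorphisms_closed[OF V[OF S(1)[OF w(1)]] z0(1)] w(2) by simp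
    ultimately show "v \<in> block X (\<star>) z0 l - {z0}" by simp
  qed
  ultimately have "card S \<le> card (block X (\<star>) z0 l - {z0})"
    using finite_block by (intro card_inj_on_le) auto
  hence "card S \<le> l" using card_block[OF z0(1)] self_in_block[OF z0(1), of l] finite_block by simp
  moreover have "card (rep ` X) = m + 1"
  proof -
    have "v \<in> orbit (rt (\<star>) x0) z0" if "v \<in> X" "v \<notin> block X (\<star>) x0 l" for v
      using len_e[OF x0 z0] len_e[OF x0 that] by (intro same_cycle[OF x0 z0(1) that(1)]) simp
    hence "X = block X (\<star>) x0 l \<union> orbit (rt (\<star>) x0) z0"
      using block_subset[of x0 l] cycle_subset[OF x0 z0(1)] by blast
    moreover have "block X (\<star>) x0 l \<inter> orbit (rt (\<star>) x0) z0 = {}"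
      using cycle_length_of_mem[OF x0 z0(1)] z0 by (auto simp: block_def)
    ultimately have "card X = card (block X (\<star>) x0 l) + card (orbit (rt (\<star>) x0) z0)"
      using finite by (metis card_Un_disjoint finite_Un)
    also have "\<dots> = (l + 1) * (m + 1)"
      using card_block[OF x0] len_e[OF x0 z0] by (simp add: cycle_length_def)
    finally show ?thesis unfolding card_eq_card_reps by (simp only: nat_mult_eq_cancel_disj) simp
  qed
  moreover have "card S \<ge> card (rep ` X) - 2"
    unfolding S_def
    using diff_card_le_card_Diff[of "{rep x0, rep z0}" "rep ` X"] card_insert_le_m1[of 2 "{rep z0}" "rep x0"]
    by simp
  ultimately have "m \<le> l + 1" by simp
  obtain c where c: "m = l * c" using l_m by (elim dvdE)
  have "c = 1"
  proof (rule ccontr)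
    assume "c \<noteq> 1"
    moreover have "c \<noteq> 0" using m c by auto
    ultimately have "l * 2 \<le> m" unfolding c by (intro mult_le_mono2) simp
    thus False using \<open>m \<le> l + 1\<close> l_gt_1 by simp
  qed
  thus ?thesis using c by simp
qed

end

section \<open>Connectedness and the lengths of the cycles\<close>

text \<open>The list of cycle lengths claimed for SHQs, as a set: \<open>K\<close> nontrivial lengths, the least being \<open>l\<close>.\<close>

definition geometric_lengths :: "'a set \<Rightarrow> ('a \<Rightarrow> 'a \<Rightarrow> 'a) \<Rightarrow> nat \<Rightarrow> nat \<Rightarrow> bool" where
  "geometric_lengths X star l K \<longleftrightarrow>
     (\<forall>x\<in>X. cycle_length star x ` X = insert 1 ((\<lambda>k. l * (l + 1) ^ k) ` {..<K}))"

lemma geometric_cases: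
  assumes "geometric_lengths X star l K" "x \<in> X" "y \<in> X"
  shows "cycle_length star x y = 1 \<or> (\<exists>k<K. cycle_length star x y = l * (l + 1) ^ k)"
proof -
  have "cycle_length star x y \<in> insert 1 ((\<lambda>k. l * (l + 1) ^ k) ` {..<K})"
    using assms(1,2) imageI[OF assms(3), of "cycle_length star x"] by (simp add: geometric_lengths_def)
  thus ?thesis by auto
qed

lemma geometric_attained:
  assumes "geometric_lengths X star l K" "x \<in> X" "k < K"
  shows "\<exists>y\<in>X. cycle_length star x y = l * (l + 1) ^ k"
proof -
  have "l * (l + 1) ^ k \<in> insert 1 ((\<lambda>k. l * (l + 1) ^ k) ` {..<K})" using assms(3) by blast
  hence "l * (l + 1) ^ k \<in> cycle_length star x ` X"
    using assms(1,2) unfolding geometric_lengths_def by metis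
  thus ?thesis by (elim imageE) metis
qed

lemma sum_geometric: "1 + (\<Sum>k<K. l * (l + 1) ^ k) = (l + 1) ^ K" for l :: nat
  by (induction K) (simp_all add: algebra_simps)

lemma geometric_inj: "l > 0 \<Longrightarrow> inj_on (\<lambda>k. l * (l + 1) ^ k) A" for l :: nat
  by (auto simp: inj_on_def)

context chain_quandle begin

lemma card_eq_sum_cycle_lengths:
  assumes x: "x \<in> X"
  shows "card X = \<Sum> (cycle_length (\<star>) x ` X)"
proof -
  have "card X = (\<Sum>d\<in>cycle_length (\<star>) x ` X. card {y \<in> X. cycle_length (\<star>) x y = d})"
    using sum.image_gen[OF finite, of "\<lambda>_. 1::nat" "cycle_length (\<star>) x"] by simp
  also have "\<dots> = (\<Sum>d\<in>cycle_length (\<star>) x ` X. d)"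
  proof (rule sum.cong[OF refl])
    fix d assume "d \<in> cycle_length (\<star>) x ` X"
    then obtain y where y: "y \<in> X" "d = cycle_length (\<star>) x y" by (elim imageE)
    have "{z \<in> X. cycle_length (\<star>) x z = d} = orbit (rt (\<star>) x) y"
    proof (intro equalityI subsetI)
      fix z assume "z \<in> {z \<in> X. cycle_length (\<star>) x z = d}"
      thus "z \<in> orbit (rt (\<star>) x) y" using same_cycle[OF x y(1)] y(2) by simp
    next
      fix z assume z: "z \<in> orbit (rt (\<star>) x) y"
      thus "z \<in> {z \<in> X. cycle_length (\<star>) x z = d}"
        using subsetD[OF cycle_subset[OF x y(1)] z] cycle_length_of_mem[OF x y(1) z] y(2) by simp
    qed
    thus "card {y \<in> X. cycle_length (\<star>) x y = d} = d" using y(2) by (simp add: cycle_length_def)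
  qed
  finally show ?thesis .
qed

lemma card_geometric:
  assumes "geometric_lengths X (\<star>) l K" "l > 1" "X \<noteq> {}"
  shows "card X = (l + 1) ^ K"
proof -
  obtain x where x: "x \<in> X" using assms(3) by auto
  have "l * (l + 1) ^ k \<noteq> 1" for k using assms(2) nat_mult_eq_1_iff[of l] by simp
  hence "1 \<notin> (\<lambda>k. l * (l + 1) ^ k) ` {..<K}" by (metis imageE)
  hence "\<Sum> (insert 1 ((\<lambda>k. l * (l + 1) ^ k) ` {..<K})) = 1 + \<Sum> ((\<lambda>k. l * (l + 1) ^ k) ` {..<K})"
    by (rule sum.insert[OF finite_imageI[OF finite_lessThan]])
  moreover have "\<Sum> ((\<lambda>k. l * (l + 1) ^ k) ` {..<K}) = (\<Sum>k<K. l * (l + 1) ^ k)"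
    using sum.reindex[OF geometric_inj, of l "\<lambda>d. d" "{..<K}"] assms(2) by simp
  moreover have "cycle_length (\<star>) x ` X = insert 1 ((\<lambda>k. l * (l + 1) ^ k) ` {..<K})"
    using assms(1) x unfolding geometric_lengths_def by metis
  ultimately have "\<Sum> (cycle_length (\<star>) x ` X) = 1 + (\<Sum>k<K. l * (l + 1) ^ k)"
    by simp
  thus ?thesis unfolding card_eq_sum_cycle_lengths[OF x] sum_geometric .
qed

end

lemma (in hereditary_chain_quandle) least_length_of_geometric:
  assumes g: "geometric_lengths X (\<star>) l K" and l: "l > 1" and K: "K > 0"
  shows "least_length X (\<star>) l"
proof (intro least_length.intro least_length_axioms.intro hereditary_chain_quandle_axioms l)
  show "\<exists>y\<in>X. cycle_length (\<star>) x y = l" if "x \<in> X" for x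
    using geometric_attained[OF g that K] by simp
  show "l dvd cycle_length (\<star>) x y" if "x \<in> X" "y \<in> X" "y \<noteq> x" for x y
    using geometric_cases[OF g that(1,2)] cycle_length_eq_1_iff[OF that(1,2)] that(3) by auto
qed

lemma (in hereditary_chain_quandle) least_length_exists:
  assumes "card X \<ge> 2"
  shows "\<exists>l. least_length X (\<star>) l"
proof -
  obtain x where x: "x \<in> X" using assms by fastforce
  have "card (X - {x}) > 0" using assms x finite by simp
  then obtain y where y: "y \<in> X" "y \<noteq> x" by (auto simp: card_gt_0_iff)
  let ?L = "cycle_length (\<star>) x ` X - {1}"
  have "cycle_length (\<star>) x y \<in> ?L" using y cycle_length_eq_1_iff[OF x y(1)] by simp
  hence L: "finite ?L" "?L \<noteq> {}" using finite by auto
  define l where "l = Min ?L"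
  have "l \<in> ?L" unfolding l_def using L by (rule Min_in)
  then obtain y0 where y0: "y0 \<in> X" "cycle_length (\<star>) x y0 = l" "l \<noteq> 1" by auto
  have l: "l > 1" using cycle_length_pos[OF x y0(1)] y0 by linarith
  have all_eq: "cycle_length (\<star>) u ` X = cycle_length (\<star>) x ` X" if "u \<in> X" for u
    using cycle_lengths_eq[OF indec that x] .
  have min: "l dvd cycle_length (\<star>) x w" if w: "w \<in> X" "cycle_length (\<star>) x w \<noteq> 1" for w
  proof -
    have le: "l \<le> cycle_length (\<star>) x w" unfolding l_def using L(1) w by (intro Min_le) auto
    from chain[OF x y0(1) w(1)] show ?thesis
    proof
      assume "cycle_length (\<star>) x w dvd cycle_length (\<star>) x y0"
      hence "cycle_length (\<star>) x w \<le> l" using y0(2) l dvd_imp_le by auto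
      thus ?thesis using le by simp
    qed (use y0(2) in simp)
  qed
  have "least_length X (\<star>) l"
  proof (intro least_length.intro least_length_axioms.intro hereditary_chain_quandle_axioms l)
    fix u assume u: "u \<in> X"
    have "l \<in> cycle_length (\<star>) u ` X" unfolding all_eq[OF u] using y0 by auto
    thus "\<exists>y\<in>X. cycle_length (\<star>) u y = l" by (elim imageE) metis
    fix v assume v: "v \<in> X" "v \<noteq> u"
    have "cycle_length (\<star>) u v \<in> cycle_length (\<star>) x ` X"
      unfolding all_eq[OF u, symmetric] using v(1) by (rule imageI)
    then obtain w where w: "w \<in> X" "cycle_length (\<star>) u v = cycle_length (\<star>) x w" by (elim imageE)
    thus "l dvd cycle_length (\<star>) u v" using min[OF w(1)] cycle_length_eq_1_iff[OF u v(1)] v(2) by simp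
  qed
  thus ?thesis ..
qed

context least_length begin

lemma block_cyclic_quandle:
  assumes x: "x \<in> X"
  shows "cyclic_quandle (block X (\<star>) x l) (\<star>)"
proof (intro cyclic_quandle.intro cyclic_quandle_axioms.intro block_quandle[OF x])
  show "indecomposable (block X (\<star>) x l) (\<star>)"
    using block_quandle[OF x] block_subset by (rule sub_indecomposable)
  show "card (block X (\<star>) x l) \<ge> 3" using card_block[OF x] l_gt_1 by simp
  fix u v assume u: "u \<in> block X (\<star>) x l" and v: "v \<in> block X (\<star>) x l" "v \<noteq> u"
  have X: "u \<in> X" "v \<in> X" using u v block_subset by auto
  have "v \<in> block X (\<star>) u l" using block_eq[OF x u] v by simp
  hence "cycle_length (\<star>) u v dvd l" by (simp add: block_def)
  hence "cycle_length (\<star>) u v = l" using l_dvd[OF X v(2)] by (rule dvd_antisym)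
  thus "cycle_length (\<star>) u v = card (block X (\<star>) x l) - 1" using card_block[OF x] by simp
qed

lemma prime_power:
  assumes "X \<noteq> {}"
  shows "\<exists>p a. prime p \<and> a > 0 \<and> l + 1 = p ^ a"
proof -
  obtain x where x: "x \<in> X" using assms by auto
  show ?thesis
    using cyclic_quandle.card_prime_power[OF block_cyclic_quandle[OF x]] card_block[OF x] by simp
qed

text \<open>\<open>T\<close> permutes the smallest blocks in a single cycle, so the power of \<open>T\<close> whose exponent is their number
maps each of them to itself. It permutes the points of each block in a single cycle, as \<open>T\<close> does
those of \<open>X\<close>; hence \<open>prime_card_of_full_cycle\<close> applies to a block.\<close>

lemma prime_of_full_cycle:
  assumes T: "T \<in> automorphisms X (\<star>)" and "X \<noteq> {}"
    and cyc: "\<And>z k. z \<in> X \<Longrightarrow> (T ^^ k) z = z \<longleftrightarrow> card X dvd k"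
  shows "prime (l + 1)"
proof -
  obtain x where x: "x \<in> X" using assms(2) by auto
  let ?Z = "block X (\<star>) x l" and ?s = "card (rep ` X)"
  note bij = automorphisms_bij[OF T]
  have s: "?s > 0" using x finite by (auto simp: card_gt_0_iff)
  have orb: "orbit T z = X" if "z \<in> X" for z
    by (rule orbit_eq_of_full_period[OF bij finite that cyc[OF that]])
  have fib: "card {u \<in> orbit T z. rep u = rep w} = l + 1" if "z \<in> X" "w \<in> orbit T z" for z w
  proof -
    have w: "w \<in> X" using that orb by simp
    have "u \<in> block X (\<star>) w l \<longleftrightarrow> rep u = rep w" if "u \<in> X" for u
      using rep_eq_iff[OF w that] by auto
    hence "{u \<in> X. rep u = rep w} = block X (\<star>) w l" using block_subset[of w l] by blast
    thus ?thesis using card_block[OF w] orb[OF that(1)] by simp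
  qed
  have per: "rep ((T ^^ ?s) z) = rep z" if z: "z \<in> X" for z
  proof -
    note * = bij finite rep_closed rep_rep rep_cong[OF T] z fib[OF z]
    have r: "card (orbit T z) = (l + 1) * card (orbit (rep \<circ> T) (rep z))"
      by (rule orbit_of_reps(1)[OF *])
    have r2: "rep ((T ^^ k) z) = rep z \<longleftrightarrow> card (orbit (rep \<circ> T) (rep z)) dvd k" for k
      by (rule orbit_of_reps(2)[OF *])
    have "(l + 1) * ?s = (l + 1) * card (orbit (rep \<circ> T) (rep z))"
      using r unfolding orb[OF z] card_eq_card_reps .
    hence "card (orbit (rep \<circ> T) (rep z)) dvd ?s" by (simp only: nat_mult_eq_cancel_disj) simp
    thus ?thesis by (rule iffD2[OF r2])
  qed
  have S: "T ^^ ?s \<in> automorphisms X (\<star>)" using automorphisms_funpow[OF T] .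
  have "x \<in> block X (\<star>) ((T ^^ ?s) x) l"
    using per[OF x] rep_eq_iff[OF automorphisms_closed[OF S x] x] by simp
  hence "block X (\<star>) ((T ^^ ?s) x) l = ?Z" using block_eq[OF automorphisms_closed[OF S x]] by simp
  hence "(T ^^ ?s) ` ?Z = ?Z" using block_automorphism_image[OF S x] by simp
  hence SZ: "T ^^ ?s \<in> automorphisms ?Z (\<star>)" by (rule automorphisms_restrict[OF S block_subset])
  have "((T ^^ ?s) ^^ k) z = z \<longleftrightarrow> card ?Z dvd k" if "z \<in> ?Z" for z k
  proof -
    have "((T ^^ ?s) ^^ k) z = z \<longleftrightarrow> card X dvd ?s * k"
      using cyc[of z "?s * k"] subsetD[OF block_subset that] by (simp add: funpow_mult mult.commute)
    thus ?thesis unfolding card_eq_card_reps mult_dvd_cancel_middle[OF s] card_block[OF x] .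
  qed
  hence "prime (card ?Z)"
    by (rule cyclic_quandle.prime_card_of_full_cycle[OF block_cyclic_quandle[OF x] SZ])
  thus ?thesis using card_block[OF x] by simp
qed

end

context chain_quandle begin

lemma complement_closed:
  assumes A: "A \<subseteq> X" "\<And>a y. \<lbrakk>a \<in> A; y \<in> X\<rbrakk> \<Longrightarrow> a \<star> y \<in> A" and "b \<in> X - A" "y \<in> X"
  shows "b \<star> y \<in> X - A"
proof -
  have inj: "inj_on (rt (\<star>) y) X" using bij_betw_imp_inj_on[OF rt_bij[OF assms(4)]] .
  have "(\<lambda>a. a \<star> y) ` A = A"
    using A(2)[OF _ assms(4)] finite_subset[OF A(1) finite] inj_on_subset[OF inj A(1)]
    by (intro endo_inj_surj) auto
  hence "b \<star> y \<in> A \<Longrightarrow> b \<star> y \<in> (\<lambda>a. a \<star> y) ` A" by simp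
  moreover have "b \<star> y \<notin> (\<lambda>a. a \<star> y) ` A"
  proof
    assume "b \<star> y \<in> (\<lambda>a. a \<star> y) ` A"
    then obtain a where "a \<in> A" "b \<star> y = a \<star> y" by (elim imageE)
    hence "b = a" using inj_onD[OF inj, of b a] assms(3) A(1) by auto
    thus False using \<open>a \<in> A\<close> assms(3) by simp
  qed
  ultimately show ?thesis using closed[of b y] assms(3,4) by auto
qed

text \<open>The block around \<open>x\<close> determined by the length of the cycle through \<open>y\<close> contains both \<open>x\<close> and \<open>y\<close>. If it
were proper, it would be connected, which is impossible for a set that meets both \<open>A\<close> and its
complement. So that length is a multiple of all lengths at \<open>x\<close>. This holds for every \<open>y\<close> outside \<open>A\<close>,
and the longest cycle is unique.\<close>

lemma complement_is_cycle:
  assumes sub: "\<And>Y. \<lbrakk>finite_quandle Y (\<star>); Y \<subset> X\<rbrakk> \<Longrightarrow> indecomposable Y (\<star>)"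
    and A: "A \<subseteq> X" "\<And>a y. \<lbrakk>a \<in> A; y \<in> X\<rbrakk> \<Longrightarrow> a \<star> y \<in> A"
    and x: "x \<in> A" and y: "y \<in> X - A"
  shows "orbit (rt (\<star>) x) y = X - A"
    and "w \<in> X \<Longrightarrow> cycle_length (\<star>) x w dvd cycle_length (\<star>) x y"
proof -
  have xX: "x \<in> X" using x A(1) by auto
  have full: "block X (\<star>) x (cycle_length (\<star>) x y) = X" if y: "y \<in> X - A" for y
  proof (rule ccontr)
    let ?Y = "block X (\<star>) x (cycle_length (\<star>) x y)"
    assume "?Y \<noteq> X"
    hence "?Y \<subset> X" using block_subset by (simp add: psubset_eq)
    with block_quandle[OF xX] have ind: "indecomposable ?Y (\<star>)" by (rule sub)
    interpret Y: finite_quandle ?Y "(\<star>)" by (rule block_quandle[OF xX])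
    have "A \<inter> ?Y = ?Y"
    proof (rule indecomposableD[OF ind])
      show "x \<in> A \<inter> ?Y" using x self_in_block[OF xX] by simp
      fix a b assume "a \<in> A \<inter> ?Y" "b \<in> ?Y"
      thus "a \<star> b \<in> A \<inter> ?Y" using A(2) Y.closed subsetD[OF block_subset] by simp
    qed simp
    moreover have "y \<in> ?Y" using y by (simp add: block_def)
    ultimately show False using y by blast
  qed
  show dvd: "cycle_length (\<star>) x w dvd cycle_length (\<star>) x y" if "w \<in> X" for w
    using full[OF y] that by (auto simp: block_def)
  show "orbit (rt (\<star>) x) y = X - A"
  proof
    show "orbit (rt (\<star>) x) y \<subseteq> X - A"
      using complement_closed[OF A _ xX] y by (intro orbit_subset_of_closed)
    show "X - A \<subseteq> orbit (rt (\<star>) x) y"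
    proof
      fix z assume z: "z \<in> X - A"
      have "cycle_length (\<star>) x y dvd cycle_length (\<star>) x z" using full[OF z] y by (auto simp: block_def)
      hence "cycle_length (\<star>) x y = cycle_length (\<star>) x z" using dvd[of z] z by (intro dvd_antisym) auto
      thus "z \<in> orbit (rt (\<star>) x) y" using same_cycle[OF xX _ _] y z by simp
    qed
  qed
qed

text \<open>A translation by an element outside \<open>A\<close> permutes \<open>A\<close> in a single cycle, so the least block size of \<open>A\<close>
is a prime \<open>p\<close>. The length \<open>p - 1\<close> at a point of \<open>A\<close> divides the longest length there, which is
the cardinality of the complement.\<close>

lemma invariant_part:
  assumes IH: "\<And>Y. \<lbrakk>chain_quandle Y (\<star>); Y \<subset> X; card Y \<ge> 2\<rbrakk> \<Longrightarrow>
      indecomposable Y (\<star>) \<and> (\<exists>l K. l > 1 \<and> K > 0 \<and> geometric_lengths Y (\<star>) l K)"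
    and sub: "\<And>Y. \<lbrakk>finite_quandle Y (\<star>); Y \<subset> X\<rbrakk> \<Longrightarrow> indecomposable Y (\<star>)"
    and A: "A \<subset> X" "A \<noteq> {}" "\<And>a y. \<lbrakk>a \<in> A; y \<in> X\<rbrakk> \<Longrightarrow> a \<star> y \<in> A"
  shows "\<exists>p K. prime p \<and> p \<ge> 3 \<and> card A = p ^ K \<and> p - 1 dvd card (X - A)"
proof -
  let ?B = "X - A"
  have AX: "A \<subseteq> X" using A(1) by auto
  obtain x where x: "x \<in> A" using A(2) by auto
  obtain y where y: "y \<in> ?B" using A(1) by auto
  have xX: "x \<in> X" using x AX by auto
  have yX: "y \<in> X" using y by auto
  have X_B: "X - ?B = A" using AX by auto
  have xB: "x \<in> X - ?B" using x X_B by simp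
  have B_closed: "b \<star> z \<in> ?B" if "b \<in> ?B" "z \<in> X" for b z
    using complement_closed[OF AX A(3) that] .
  have Aorb: "orbit (rt (\<star>) y) z = A" if "z \<in> A" for z
    using complement_is_cycle(1)[OF sub Diff_subset B_closed y, of z] that X_B by simp
  have finA: "finite A" using AX finite by (rule finite_subset)
  have qA: "finite_quandle A (\<star>)"
    using A(3) AX by (intro subquandleI[OF AX]) auto
  have card_A: "card A \<ge> 2"
  proof (rule ccontr)
    assume "\<not> card A \<ge> 2"
    hence "card A = 1" using A(2) finA card_gt_0_iff[of A] by linarith
    hence "A = {x}" using x by (auto simp: card_1_singleton_iff)
    hence "cycle_length (\<star>) y x = 1" using Aorb[OF x] by (simp add: cycle_length_def)
    hence "x = y" using cycle_length_eq_1_iff[OF yX xX] by simp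
    thus False using x y by simp
  qed
  obtain l K where lK: "l > 1" "K > 0" "geometric_lengths A (\<star>) l K"
    using IH[OF chain_subquandle[OF qA AX] A(1) card_A] by auto
  have h: "hereditary_chain_quandle A (\<star>)"
  proof (intro hereditary_chain_quandle.intro hereditary_chain_quandle_axioms.intro chain_subquandle[OF qA AX])
    fix Y assume "finite_quandle Y (\<star>)" "Y \<subseteq> A"
    thus "indecomposable Y (\<star>)" using sub A(1) by blast
  qed
  have ll: "least_length A (\<star>) l"
    by (rule hereditary_chain_quandle.least_length_of_geometric[OF h lK(3,1,2)])
  have "rt (\<star>) y ` A = A"
  proof (rule endo_inj_surj[OF finA])
    show "rt (\<star>) y ` A \<subseteq> A" using A(3)[OF _ yX] by auto
    show "inj_on (rt (\<star>) y) A" using bij_betw_imp_inj_on[OF rt_bij[OF yX]] AX by (rule inj_on_subset)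
  qed
  hence T: "rt (\<star>) y \<in> automorphisms A (\<star>)" by (rule automorphisms_restrict[OF rt_automorphism[OF yX] AX])
  have "(rt (\<star>) y ^^ k) z = z \<longleftrightarrow> card A dvd k" if "z \<in> A" for z k
    using cycle_length_dvd_iff[OF yX subsetD[OF AX that], of k] Aorb[OF that] by (simp add: cycle_length_def)
  hence p: "prime (l + 1)" by (rule least_length.prime_of_full_cycle[OF ll T A(2)])
  moreover have "card A = (l + 1) ^ K"
    by (rule chain_quandle.card_geometric[OF chain_subquandle[OF qA AX] lK(3,1) A(2)])
  moreover have "l dvd card ?B"
  proof -
    obtain w where w: "w \<in> A" "cycle_length (\<star>) x w = l"
      using geometric_attained[OF lK(3) x lK(2)] by auto
    have "l dvd cycle_length (\<star>) x y"
      using complement_is_cycle(2)[OF sub AX A(3) x y subsetD[OF AX w(1)]] w(2) by simp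
    thus ?thesis using complement_is_cycle(1)[OF sub AX A(3) x y] by (simp add: cycle_length_def)
  qed
  ultimately show ?thesis using lK(1) by (intro exI[of _ "l + 1"] exI[of _ K]) auto
qed

lemma primes_descend:
  assumes "prime p" "prime r" "(p::nat) \<ge> 3" "p - 1 dvd r ^ K"
  shows "r < p"
proof -
  have "p - 1 \<noteq> 1" using assms(3) by simp
  then obtain s where s: "prime s" "s dvd p - 1" using prime_factor_nat by blast
  hence "s dvd r ^ K" using assms(4) dvd_trans by blast
  hence "s = r" using s(1) assms(2) prime_dvd_power primes_dvd_imp_eq by blast
  hence "r \<le> p - 1" using s(2) assms(3) by (intro dvd_imp_le) auto
  thus ?thesis using assms(3) by simp
qed

lemma indecomposable_step:
  assumes IH: "\<And>Y. \<lbrakk>chain_quandle Y (\<star>); Y \<subset> X; card Y \<ge> 2\<rbrakk> \<Longrightarrow>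
      indecomposable Y (\<star>) \<and> (\<exists>l K. l > 1 \<and> K > 0 \<and> geometric_lengths Y (\<star>) l K)"
    and sub: "\<And>Y. \<lbrakk>finite_quandle Y (\<star>); Y \<subset> X\<rbrakk> \<Longrightarrow> indecomposable Y (\<star>)"
  shows "indecomposable X (\<star>)"
  unfolding indecomposable_def
proof (intro allI impI, elim conjE, rule ccontr)
  fix A assume A: "A \<subseteq> X" "A \<noteq> {}" "\<forall>a\<in>A. \<forall>y\<in>X. a \<star> y \<in> A" "A \<noteq> X"
  have c: "a \<star> y \<in> A" if "a \<in> A" "y \<in> X" for a y using A(3) that by blast
  have X_B: "X - (X - A) = A" using A(1) by auto
  have "A \<subset> X" using A(1,4) by auto
  obtain p K where p: "prime p" "p \<ge> 3" "card A = p ^ K" "p - 1 dvd card (X - A)"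
    using invariant_part[OF IH sub \<open>A \<subset> X\<close> A(2) c] by auto
  have cB: "b \<star> y \<in> X - A" if "b \<in> X - A" "y \<in> X" for b y
    using complement_closed[OF A(1) c that] .
  have B: "X - A \<subset> X" "X - A \<noteq> {}" using A by auto
  obtain r J where r: "prime r" "r \<ge> 3" "card (X - A) = r ^ J" "r - 1 dvd card A"
    using invariant_part[OF IH sub B cB] X_B by auto
  have "r < p" using primes_descend[OF p(1) r(1) p(2)] p(4) r(3) by simp
  moreover have "p < r" using primes_descend[OF r(1) p(1) r(2)] r(4) p(3) by simp
  ultimately show False by simp
qed

end

context least_length begin

lemma one_attained: "x \<in> X \<Longrightarrow> 1 \<in> cycle_length (\<star>) x ` X"
  using imageI[of x X "cycle_length (\<star>) x"] cycle_length_self[of x] by simp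

lemma l_mem_lengths: assumes "x \<in> X" shows "l \<in> cycle_length (\<star>) x ` X"
  using l_attained[OF assms] by (elim bexE) (metis imageI)

text \<open>The quotient yields the lengths up to the value \<open>l'\<close> of its own least length. The comparison of \<open>l'\<close>
with \<open>l\<close> takes place in the block \<open>?D\<close> around \<open>x\<^sub>0\<close>, where only the three smallest lengths survive.\<close>

lemma geometric_step:
  assumes card: "card X \<ge> 2"
    and IH: "\<And>(Y :: 'a set) star'. \<lbrakk>chain_quandle Y star'; card Y < card X; card Y \<ge> 2\<rbrakk> \<Longrightarrow>
      \<exists>l K. l > 1 \<and> K > 0 \<and> geometric_lengths Y star' l K"
  shows "\<exists>K>0. geometric_lengths X (\<star>) l K"
proof (cases "\<exists>x\<in>X. block X (\<star>) x l = X")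
  case True
  then obtain x0 where x0: "x0 \<in> X" "block X (\<star>) x0 l = X" by auto
  have "cycle_length (\<star>) x0 ` X = insert 1 {l}"
  proof (intro equalityI subsetI)
    fix d assume "d \<in> cycle_length (\<star>) x0 ` X"
    then obtain w where w: "w \<in> X" "d = cycle_length (\<star>) x0 w" by (elim imageE)
    have "d dvd l" using w x0(2) by (auto simp: block_def)
    thus "d \<in> insert 1 {l}"
      using l_dvd[OF x0(1) w(1)] cycle_length_self[OF x0(1)] w(2) dvd_antisym by auto
  next
    fix d assume "d \<in> insert 1 {l}"
    moreover have "1 \<in> cycle_length (\<star>) x0 ` X" by (rule one_attained[OF x0(1)])
    moreover have "l \<in> cycle_length (\<star>) x0 ` X" by (rule l_mem_lengths[OF x0(1)])
    ultimately show "d \<in> cycle_length (\<star>) x0 ` X" by auto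
  qed
  hence "geometric_lengths X (\<star>) l 1"
    unfolding geometric_lengths_def using cycle_lengths_all_eq[OF x0(1)] by (auto simp: lessThan_Suc)
  thus ?thesis by (intro exI[of _ 1]) simp
next
  case False
  have nontriv: "\<exists>z\<in>X. z \<notin> block X (\<star>) x l" if "x \<in> X" for x
    using False that block_subset by blast
  let ?Q = "rep ` X"
  interpret Q: chain_quandle ?Q quotient_op by (rule quotient_chain_quandle(1)[OF nontriv])
  have Qlen: "cycle_length (\<star>) x y = (l + 1) * cycle_length quotient_op x y" "y \<notin> block X (\<star>) x l"
    if "x \<in> ?Q" "y \<in> ?Q" "y \<noteq> x" for x y
    using quotient_chain_quandle(2)[OF nontriv that] by auto
  have Q_X: "u \<in> X" if "u \<in> ?Q" for u using that rep_closed by auto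
  obtain x where x: "x \<in> X" using card by fastforce
  define x0 where "x0 = rep x"
  have x0: "x0 \<in> ?Q" "x0 \<in> X" using x rep_closed unfolding x0_def by auto
  obtain z where z: "z \<in> X" "z \<notin> block X (\<star>) x l" using nontriv[OF x] by auto
  have "rep x \<noteq> rep z" using rep_eq_iff[OF x z(1)] z(2) by simp
  hence "card {rep x, rep z} = 2" by simp
  moreover have "card {rep x, rep z} \<le> card ?Q" using x z(1) finite by (intro card_mono) auto
  ultimately have Q2: "card ?Q \<ge> 2" by simp
  have "card ?Q < card X" using card_eq_card_reps l_gt_1 Q2 by simp
  then obtain l' K where lK: "l' > 1" "K > 0" "geometric_lengths ?Q quotient_op l' K"
    using IH[OF Q.chain_quandle_axioms _ Q2] by auto
  have lens: "cycle_length (\<star>) x0 ` X =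
      insert 1 (insert l ((\<lambda>k. (l + 1) * (l' * (l' + 1) ^ k)) ` {..<K}))" (is "?L = ?R")
  proof (intro equalityI subsetI)
    fix d assume "d \<in> ?L"
    then obtain w where w: "w \<in> X" "d = cycle_length (\<star>) x0 w" by (elim imageE)
    show "d \<in> ?R"
    proof (cases "w \<in> block X (\<star>) x0 l")
      case True
      hence "d dvd l" using w(2) by (simp add: block_def)
      thus ?thesis
        using l_dvd[OF x0(2) w(1)] cycle_length_self[OF x0(2)] w(2) dvd_antisym by (cases "w = x0") auto
    next
      case False
      have rw: "rep w \<in> ?Q" using w(1) by simp
      have d: "d = cycle_length (\<star>) x0 (rep w)"
        using cycle_length_block_mate[OF x0(2) w(1) False rep_in_block[OF w(1)]] w(2) by simp
      have ne: "rep w \<noteq> x0"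
      proof
        assume "rep w = x0"
        hence "rep w = rep x0" using rep_rep[OF x] by (simp add: x0_def)
        thus False using rep_eq_iff[OF x0(2) w(1)] False by simp
      qed
      hence "cycle_length quotient_op x0 (rep w) \<noteq> 1" using Q.cycle_length_eq_1_iff[OF x0(1) rw] by simp
      then obtain k where "k < K" "cycle_length quotient_op x0 (rep w) = l' * (l' + 1) ^ k"
        using geometric_cases[OF lK(3) x0(1) rw] by auto
      thus ?thesis using Qlen(1)[OF x0(1) rw ne] d by auto
    qed
  next
    fix d assume "d \<in> ?R"
    then consider "d = 1" | "d = l" | k where "k < K" "d = (l + 1) * (l' * (l' + 1) ^ k)" by auto
    thus "d \<in> ?L"
    proof cases
      case 1 thus ?thesis using one_attained[OF x0(2)] by simp
    next
      case 2 thus ?thesis using l_mem_lengths[OF x0(2)] by simp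
    next
      case 3
      obtain y where y: "y \<in> ?Q" "cycle_length quotient_op x0 y = l' * (l' + 1) ^ k"
        using geometric_attained[OF lK(3) x0(1) 3(1)] by auto
      have "y \<noteq> x0" using y(2) Q.cycle_length_self[OF x0(1)] lK(1) by auto
      hence "d = cycle_length (\<star>) x0 y" using Qlen(1)[OF x0(1) y(1)] y(2) 3(2) by simp
      thus ?thesis using Q_X[OF y(1)] by simp
    qed
  qed
  \<comment> \<open>The second smallest nontrivial length: \<open>l + 1\<close> times the least nontrivial length of the quotient.\<close>
  let ?e = "(l + 1) * l'"
  have "?e \<in> (\<lambda>k. (l + 1) * (l' * (l' + 1) ^ k)) ` {..<K}"
    using imageI[of 0 "{..<K}" "\<lambda>k. (l + 1) * (l' * (l' + 1) ^ k)"] lK(2) by simp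
  hence "?e \<in> cycle_length (\<star>) x0 ` X" unfolding lens by blast
  then obtain z0 where z0: "z0 \<in> X" "cycle_length (\<star>) x0 z0 = ?e" by (elim imageE) simp
  have "?e \<noteq> 1" using mult_le_mono1[of 1 "l + 1" l'] lK(1) by linarith
  hence "z0 \<noteq> x0" using z0(2) cycle_length_self[OF x0(2)] by metis
  hence l_e: "l dvd ?e" using l_dvd[OF x0(2) z0(1)] z0(2) by simp
  let ?D = "block X (\<star>) x0 ?e"
  have DX: "u \<in> X" if "u \<in> ?D" for u using that block_subset by auto
  have D_block: "cycle_length (\<star>) u v dvd ?e" if "u \<in> ?D" "v \<in> ?D" for u v
    using block_eq[OF x0(2) that(1)] that(2) by (auto simp: block_def)
  have "least_length ?D (\<star>) l"
  proof (intro least_length.intro least_length_axioms.intro l_gt_1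
      hereditary_subquandle[OF block_quandle[OF x0(2)] block_subset])
    fix u assume u: "u \<in> ?D"
    obtain v where v: "v \<in> X" "cycle_length (\<star>) u v = l" using l_attained[OF DX[OF u]] by auto
    have "v \<in> block X (\<star>) u ?e" using v l_e by (simp add: block_def)
    hence "v \<in> ?D" using block_eq[OF x0(2) u] by simp
    thus "\<exists>y\<in>?D. cycle_length (\<star>) u y = l" using v(2) by blast
    fix v assume "v \<in> ?D" "v \<noteq> u"
    thus "l dvd cycle_length (\<star>) u v" using l_dvd[OF DX[OF u] DX] by simp
  qed
  then interpret D: least_length ?D "(\<star>)" l .
  have "l' = l"
  proof (rule D.three_lengths)
    fix u v assume u: "u \<in> ?D" and v: "v \<in> ?D"
    have "cycle_length (\<star>) u v \<in> cycle_length (\<star>) x0 ` X"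
      unfolding cycle_lengths_all_eq[OF x0(2) DX[OF u]] using DX[OF v] by (rule imageI)
    then consider "cycle_length (\<star>) u v \<in> {1, l}"
      | k where "cycle_length (\<star>) u v = (l + 1) * (l' * (l' + 1) ^ k)" unfolding lens by auto
    thus "cycle_length (\<star>) u v \<in> {1, l, ?e}"
    proof cases
      case 2
      have "?e * (l' + 1) ^ k dvd ?e * 1" using D_block[OF u v] unfolding 2 by (simp only: mult.assoc mult_1_right)
      hence "(l' + 1) ^ k dvd 1" using lK(1) by (simp only: nat_mult_dvd_cancel_disj) simp
      hence "(l' + 1) ^ k = 1" by (simp only: nat_dvd_1_iff_1)
      hence "cycle_length (\<star>) u v = ?e" unfolding 2 by (simp only: mult_1_right)
      thus ?thesis by simp
    qed auto
  next
    show "x0 \<in> ?D" using self_in_block[OF x0(2)] .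
    show "z0 \<in> ?D" using z0 by (simp add: block_def)
    have "\<not> ?e dvd l"
    proof
      assume "?e dvd l"
      hence "(l + 1) * l' \<le> l" using l_gt_1 by (intro dvd_imp_le) auto
      moreover have "(l + 1) * 1 \<le> (l + 1) * l'" using lK(1) by (intro mult_le_mono2) simp
      ultimately show False by simp
    qed
    thus "z0 \<notin> block ?D (\<star>) x0 l" using z0(2) by (simp add: block_def)
  qed
  hence "cycle_length (\<star>) x0 ` X = insert 1 ((\<lambda>k. l * (l + 1) ^ k) ` {..<Suc K})"
    unfolding lens lessThan_Suc_eq_insert_0 by (simp add: image_image mult.left_commute)
  hence "geometric_lengths X (\<star>) l (Suc K)"
    unfolding geometric_lengths_def using cycle_lengths_all_eq[OF x0(2)] by simp
  thus ?thesis by blast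
qed

end

lemma indecomposable_of_card_le_1:
  assumes "finite Y" "card Y \<le> 1" shows "indecomposable Y star"
  unfolding indecomposable_def
proof (intro allI impI, elim conjE)
  fix A assume A: "A \<subseteq> Y" "A \<noteq> {}"
  have "card A > 0" using A finite_subset[OF A(1) assms(1)] by (simp add: card_gt_0_iff)
  thus "A = Y" using assms A(1) by (intro card_seteq) auto
qed

theorem chain_quandle_structure:
  assumes "chain_quandle X star" "card X \<ge> 2"
  shows "indecomposable X star \<and>
    (\<exists>l K. l > 1 \<and> K > 0 \<and> geometric_lengths X star l K \<and> (\<exists>p a. prime p \<and> a > 0 \<and> l + 1 = p ^ a))"
  using assms
proof (induction "card X" arbitrary: X star rule: less_induct)
  case less
  interpret chain_quandle X star by (rule less.prems(1))
  have sub: "indecomposable Y star" if "finite_quandle Y star" "Y \<subset> X" for Y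
  proof (cases "card Y \<ge> 2")
    case True
    have "card Y < card X" using psubset_card_mono[OF finite that(2)] .
    thus ?thesis using less.hyps chain_subquandle[OF that(1)] that(2) True by blast
  next
    case False
    thus ?thesis using finite_quandle.finite[OF that(1)] by (intro indecomposable_of_card_le_1) auto
  qed
  have ind: "indecomposable X star"
  proof (rule indecomposable_step[OF _ sub])
    fix Y assume "chain_quandle Y star" "Y \<subset> X" "card Y \<ge> 2"
    thus "indecomposable Y star \<and> (\<exists>l K. l > 1 \<and> K > 0 \<and> geometric_lengths Y star l K)"
      using less.hyps[of Y star] psubset_card_mono[OF finite] by blast
  qed
  have "hereditary_chain_quandle X star"
    using sub ind
    by (intro hereditary_chain_quandle.intro hereditary_chain_quandle_axioms.intro chain_quandle_axioms) blast
  then obtain l where ll: "least_length X star l"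
    using hereditary_chain_quandle.least_length_exists[OF _ less.prems(2)] by blast
  have "\<exists>K>0. geometric_lengths X star l K"
  proof (rule least_length.geometric_step[OF ll less.prems(2)])
    fix Y :: "'a set" and star' assume "chain_quandle Y star'" "card Y < card X" "card Y \<ge> 2"
    thus "\<exists>l K. l > 1 \<and> K > 0 \<and> geometric_lengths Y star' l K" using less.hyps by blast
  qed
  moreover have "X \<noteq> {}" using less.prems(2) by auto
  ultimately show ?case
    using ind least_length.prime_power[OF ll] least_length.l_gt_1[OF ll] by blast
qed

section \<open>Subquandles are blocks\<close>

lemma chain_quandle_hereditary:
  assumes "chain_quandle X star"
  shows "hereditary_chain_quandle X star"
proof (intro hereditary_chain_quandle.intro hereditary_chain_quandle_axioms.intro assms)
  fix Y assume Y: "finite_quandle Y star" "Y \<subseteq> X"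
  show "indecomposable Y star"
  proof (cases "card Y \<ge> 2")
    case True
    thus ?thesis using chain_quandle_structure chain_quandle.chain_subquandle[OF assms Y] by blast
  next
    case False
    thus ?thesis using finite_quandle.finite[OF Y(1)] by (intro indecomposable_of_card_le_1) auto
  qed
qed

lemma filter_insert_image:
  assumes "P a" "\<And>k. P (f k) \<longleftrightarrow> Q k"
  shows "{e \<in> insert a (f ` A). P e} = insert a (f ` {k \<in> A. Q k})"
  using assms by blast

context hereditary_chain_quandle begin

lemma cycle_lengths_block:
  assumes x: "x \<in> X" and y: "y \<in> block X (\<star>) x d"
  shows "cycle_length (\<star>) y ` block X (\<star>) x d = {e \<in> cycle_length (\<star>) y ` X. e dvd d}"
  unfolding block_eq[OF x y, symmetric] by (auto simp: block_def)

lemma geometric_block: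
  assumes g: "geometric_lengths X (\<star>) l K" and l: "l > 1" and m: "m < K" and x: "x \<in> X"
  shows "geometric_lengths (block X (\<star>) x (l * (l + 1) ^ m)) (\<star>) l (Suc m)"
  unfolding geometric_lengths_def
proof
  let ?d = "l * (l + 1) ^ m"
  fix y assume y: "y \<in> block X (\<star>) x ?d"
  have yX: "y \<in> X" using y block_subset by auto
  have dvd_iff: "l * (l + 1) ^ k dvd ?d \<longleftrightarrow> k \<le> m" for k
  proof -
    have "l * (l + 1) ^ k dvd ?d \<longleftrightarrow> (l + 1) ^ k dvd (l + 1) ^ m"
      using l by (simp only: nat_mult_dvd_cancel_disj) simp
    also have "\<dots> \<longleftrightarrow> k \<le> m"
      using power_dvd_imp_le[of "l + 1" k m] le_imp_power_dvd[of k m "l + 1"] l by linarith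
    finally show ?thesis .
  qed
  have "{e \<in> insert 1 ((\<lambda>k. l * (l + 1) ^ k) ` {..<K}). e dvd ?d} =
      insert 1 ((\<lambda>k. l * (l + 1) ^ k) ` {k \<in> {..<K}. k \<le> m})"
    using dvd_iff by (intro filter_insert_image one_dvd)
  also have "{k \<in> {..<K}. k \<le> m} = {..<Suc m}" using m by auto
  also have "insert 1 ((\<lambda>k. l * (l + 1) ^ k) ` {..<K}) = cycle_length (\<star>) y ` X"
    using g yX unfolding geometric_lengths_def by metis
  finally show "cycle_length (\<star>) y ` block X (\<star>) x ?d = insert 1 ((\<lambda>k. l * (l + 1) ^ k) ` {..<Suc m})"
    unfolding cycle_lengths_block[OF x y] .
qed

text \<open>Let \<open>z\<close> have the greatest length \<open>d\<close> at \<open>y\<close> within \<open>Y\<close>, and let \<open>e\<close> be a smaller length at \<open>y\<close> in \<open>X\<close>.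
A point \<open>u\<close> with \<open>\<lambda>(z,u) = e\<close> still satisfies \<open>\<lambda>(y,u) = d\<close> by the ultrametric inequality, so it is on the
cycle of \<open>z\<close> and in \<open>Y\<close>. The length \<open>e\<close> therefore occurs in \<open>Y\<close> at \<open>z\<close>, hence also at \<open>y\<close>, because \<open>Y\<close>
is connected; and the only cycle of that length at \<open>y\<close> is contained in \<open>Y\<close>.\<close>

theorem subquandle_is_block:
  assumes Y: "finite_quandle Y (\<star>)" "Y \<subseteq> X" and y: "y \<in> Y"
  shows "\<exists>z\<in>Y. Y = block X (\<star>) y (cycle_length (\<star>) y z)"
proof -
  interpret Y: hereditary_chain_quandle Y "(\<star>)" by (rule hereditary_subquandle[OF Y])
  have X: "u \<in> X" if "u \<in> Y" for u using that Y(2) by auto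
  have all_eq: "cycle_length (\<star>) u ` X = cycle_length (\<star>) v ` X" if "u \<in> X" "v \<in> X" for u v
    using cycle_lengths_eq[OF indec that] .
  have same: "w \<in> Y" if "u \<in> Y" "v \<in> Y" "w \<in> X" "cycle_length (\<star>) u v = cycle_length (\<star>) u w" for u v w
    using same_cycle[OF X[OF that(1)] X[OF that(2)] that(3,4)] Y.cycle_subset[OF that(1,2)] by auto
  obtain z where z: "z \<in> Y" "\<And>w. w \<in> Y \<Longrightarrow> cycle_length (\<star>) y w dvd cycle_length (\<star>) y z"
    using Y.longest_cycle[OF y] by auto
  let ?d = "cycle_length (\<star>) y z"
  have "w \<in> Y" if w: "w \<in> block X (\<star>) y ?d" for w
  proof (cases "cycle_length (\<star>) y w = ?d")
    case True
    thus ?thesis using same[OF y z(1), of w] w by (simp add: block_def)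
  next
    case False
    let ?e = "cycle_length (\<star>) y w"
    have wX: "w \<in> X" and e: "?e dvd ?d" using w by (auto simp: block_def)
    have "?e \<in> cycle_length (\<star>) z ` X"
      unfolding all_eq[OF X[OF z(1)] X[OF y]] using wX by (rule imageI)
    then obtain u where u: "u \<in> X" "cycle_length (\<star>) z u = ?e" by (elim imageE) simp
    have "cycle_length (\<star>) y u = ?d"
    proof -
      have yu: "cycle_length (\<star>) y u dvd ?d"
        using ultrametric[OF X[OF y] X[OF z(1)] u(1), of ?d] u(2) e by simp
      have uz: "cycle_length (\<star>) u z = ?e" using cycle_length_sym[OF X[OF z(1)] u(1)] u(2) by simp
      from chain[OF X[OF y] u(1) wX] show ?thesis
      proof
        assume "cycle_length (\<star>) y u dvd ?e"
        hence "?d dvd ?e" using ultrametric[OF X[OF y] u(1) X[OF z(1)], of ?e] uz by simp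
        thus ?thesis using False e dvd_antisym by blast
      next
        assume "?e dvd cycle_length (\<star>) y u"
        hence "?d dvd cycle_length (\<star>) y u"
          using ultrametric[OF X[OF y] u(1) X[OF z(1)] dvd_refl] uz by simp
        thus ?thesis using yu dvd_antisym by blast
      qed
    qed
    hence uY: "u \<in> Y" using same[OF y z(1) u(1)] by simp
    have "?e \<in> cycle_length (\<star>) y ` Y"
      unfolding u(2)[symmetric] Y.cycle_lengths_eq[OF Y.indec y z(1)] using uY by (rule imageI)
    then obtain v where "v \<in> Y" "?e = cycle_length (\<star>) y v" by (elim imageE)
    thus ?thesis using same[OF y _ wX] by simp
  qed
  moreover have "w \<in> block X (\<star>) y ?d" if "w \<in> Y" for w
    using z(2)[OF that] X[OF that] by (simp add: block_def)
  ultimately have "Y = block X (\<star>) y ?d" by blast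
  thus ?thesis using z(1) by blast
qed

lemma blocks_isomorphic:
  assumes "x \<in> X" "y \<in> X"
  shows "quandle_isomorphic (block X (\<star>) y d) (\<star>) (block X (\<star>) x d) (\<star>)"
proof -
  obtain f where f: "f \<in> automorphisms X (\<star>)" "f y = x" using transitive[OF assms(2,1)] by (elim bexE)
  have "inj_on f (block X (\<star>) y d)"
    using bij_betw_imp_inj_on[OF automorphisms_bij[OF f(1)]] block_subset by (rule inj_on_subset)
  moreover have "f ` block X (\<star>) y d = block X (\<star>) x d"
    using block_automorphism_image[OF f(1) assms(2)] f(2) by simp
  ultimately have "bij_betw f (block X (\<star>) y d) (block X (\<star>) x d)" by (rule bij_betw_imageI)
  moreover have "f (u \<star> v) = f u \<star> f v" if "u \<in> block X (\<star>) y d" "v \<in> block X (\<star>) y d" for u v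
    using automorphisms_hom[OF f(1)] subsetD[OF block_subset] that by metis
  ultimately show ?thesis unfolding quandle_isomorphic_def by blast
qed

end

section \<open>Profiles and labelings\<close>

text \<open>The orbit of a point under the group generated by the translations is invariant under translations.\<close>

lemma connected_quandleI:
  assumes "finite_quandle Y star" "indecomposable Y star"
  shows "connected_quandle Y star"
proof -
  interpret finite_quandle Y star by (rule assms(1))
  let ?R = "right_translation Y star" and ?G = "BijGroup Y"
  have R: "?R z \<in> Bij Y" if "z \<in> Y" for z
    using rt_bij[OF that] by (simp add: right_translation_def Bij_def cong: bij_betw_cong)
  have "\<exists>g\<in>right_translation_group Y star. g x = y" if x: "x \<in> Y" and y: "y \<in> Y" for x y
  proof -
    let ?H = "right_translation_group Y star"
    let ?A = "(\<lambda>g. g x) ` ?H"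
    have H: "?H \<subseteq> Bij Y"
      using group.generate_incl[OF group_BijGroup, of "?R ` Y" Y] R
      unfolding right_translation_group_def by (auto simp: BijGroup_def)
    have "?A = Y"
    proof (rule indecomposableD[OF assms(2)])
      show "?A \<subseteq> Y"
      proof (rule image_subsetI)
        fix g assume "g \<in> ?H"
        hence "g \<in> Bij Y" using H by auto
        thus "g x \<in> Y" using Bij_imp_funcset[of g Y] x by auto
      qed
      have "\<one>\<^bsub>?G\<^esub> \<in> ?H" unfolding right_translation_group_def by (rule generate.one)
      hence "(\<lambda>g. g x) \<one>\<^bsub>?G\<^esub> \<in> ?A" by (rule imageI)
      thus "x \<in> ?A" using x by (simp add: BijGroup_def)
      fix a z assume a: "a \<in> ?A" and z: "z \<in> Y"
      obtain g where g: "g \<in> ?H" "a = g x" using a by (elim imageE)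
      have gB: "g \<in> Bij Y" using g(1) H by auto
      have "?R z \<otimes>\<^bsub>?G\<^esub> g \<in> ?H"
        using generate.eng[OF generate.incl[OF imageI[OF z]] g(1)[unfolded right_translation_group_def]]
        unfolding right_translation_group_def .
      hence "(\<lambda>g. g x) (?R z \<otimes>\<^bsub>?G\<^esub> g) \<in> ?A" by (rule imageI)
      moreover have "?R z \<otimes>\<^bsub>?G\<^esub> g = compose Y (?R z) g"
        using R[OF z] gB by (simp add: BijGroup_def)
      moreover have "compose Y (?R z) g x = star a z"
        using g(2) x Bij_imp_funcset[OF gB] by (auto simp: compose_eq right_translation_def)
      ultimately show "star a z \<in> ?A" by simp
    qed
    hence "y \<in> ?A" using y by simp
    thus ?thesis by (elim imageE) metis
  qed
  thus ?thesis unfolding connected_quandle_def using quandle_axioms by blast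
qed

lemma (in finite_quandle) orbit_right_translation:
  assumes "x \<in> X" "y \<in> X"
  shows "orbit (right_translation X (\<star>) x) y = orbit (rt (\<star>) x) y"
proof -
  have "(right_translation X (\<star>) x ^^ n) y = (rt (\<star>) x ^^ n) y" for n
    using closed assms by (intro funpow_cong_on[of X]) (auto simp: right_translation_def)
  thus ?thesis unfolding orbit_altdef by simp
qed

text \<open>Turns a cycle structure without repetitions into the statement that cycles are told apart by their
lengths.\<close>

lemma sorted_list_of_distinct_image_mset:
  assumes "finite A" "sorted_list_of_multiset (image_mset f (mset_set A)) = L" "distinct L"
  shows "inj_on f A \<and> f ` A = set L"
proof -
  have L: "mset L = image_mset f (mset_set A)" using assms(2) by auto
  have s: "set L = f ` A" using arg_cong[OF L, of set_mset] assms(1) by simp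
  have "length L = card A" using arg_cong[OF L, of size] by simp
  hence "card (f ` A) = card A" using distinct_card[OF assms(3)] s by simp
  thus ?thesis using s assms(1) eq_card_imp_inj_on by blast
qed

lemma increasing_divisor_chain:
  fixes l :: "nat \<Rightarrow> nat"
  assumes "\<forall>i\<in>{2..c}. l (i - 1) < l i \<and> l (i - 1) dvd l i" "1 \<le> i" "i \<le> j" "j \<le> c"
  shows "l i dvd l j \<and> (i < j \<longrightarrow> l i < l j)"
  using assms(3,4)
proof (induction j rule: dec_induct)
  case (step n)
  have "l n < l (Suc n) \<and> l n dvd l (Suc n)"
    using bspec[OF assms(1), of "Suc n"] assms(2) step by simp
  thus ?case using step dvd_trans[of "l i" "l n"] by (cases "i = n") auto
qed simp

text \<open>In an SHQ the number \<open>c\<close> and the lengths \<open>l\<close> may vary with \<open>x\<close>; accordingly a chain quandle compares only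
lengths of cycles of the same translation.\<close>

lemma SHQ_chain_quandle:
  assumes "SHQ X star"
  shows "chain_quandle X star" "card X \<ge> 2"
proof -
  have "quandle X star" "finite X" using assms by (auto simp: SHQ_def)
  then interpret finite_quandle X star
    by (intro finite_quandle.intro finite_quandle_axioms.intro)
  let ?O = "\<lambda>x. orbit (right_translation X star x) ` X"
  have *: "\<exists>(c::nat) l. c \<ge> 2 \<and> (\<forall>i\<in>{2..c}. l (i - 1) < l i \<and> l (i - 1) dvd l i) \<and> l 1 = 1 \<and>
    inj_on card (?O x) \<and> card ` ?O x = l ` {1..c}" if x: "x \<in> X" for x
  proof -
    obtain c and l :: "nat \<Rightarrow> nat" where cl: "c \<ge> 2"
      "cycle_structure X (right_translation X star x) = map l [1..<Suc c]" "l 1 = 1"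
      "\<forall>i\<in>{2..c}. l (i - 1) < l i \<and> l (i - 1) dvd l i"
      using assms x unfolding SHQ_def by blast
    have "inj_on l {1..c}"
    proof (rule linorder_inj_onI)
      fix i j assume "i < j" "i \<in> {1..c}" "j \<in> {1..c}"
      thus "l i \<noteq> l j" using increasing_divisor_chain[OF cl(4), of i j] by auto
    qed auto
    hence "distinct (map l [1..<Suc c])" by (simp add: distinct_map atLeastLessThanSuc_atLeastAtMost del: upt_Suc)
    with finite_imageI[OF finite] cl(2)[unfolded cycle_structure_def]
    have "inj_on card (?O x) \<and> card ` ?O x = set (map l [1..<Suc c])"
      by (rule sorted_list_of_distinct_image_mset)
    moreover have "set (map l [1..<Suc c]) = l ` {1..c}"
      by (simp add: atLeastLessThanSuc_atLeastAtMost del: upt_Suc)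
    ultimately show ?thesis using cl by metis
  qed
  have len: "cycle_length star x y = card (orbit (right_translation X star x) y)" if "x \<in> X" "y \<in> X" for x y
    using orbit_right_translation[OF that] by (simp add: cycle_length_def)
  show "chain_quandle X star"
  proof (intro chain_quandle.intro chain_quandle_axioms.intro finite_quandle_axioms)
    fix x y z assume xyz: "x \<in> X" "y \<in> X" "z \<in> X"
    obtain c and l :: "nat \<Rightarrow> nat" where cl: "\<forall>i\<in>{2..c}. l (i - 1) < l i \<and> l (i - 1) dvd l i"
      "inj_on card (?O x)" "card ` ?O x = l ` {1..c}" using *[OF xyz(1)] by blast
    have "cycle_length star x u \<in> l ` {1..c}" if "u \<in> X" for u
      unfolding cl(3)[symmetric] len[OF xyz(1) that] using that by (intro imageI)
    hence "cycle_length star x y \<in> l ` {1..c}" "cycle_length star x z \<in> l ` {1..c}" using xyz(2,3) by auto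
    then obtain i j where ij: "i \<in> {1..c}" "cycle_length star x y = l i" "j \<in> {1..c}" "cycle_length star x z = l j"
      by (elim imageE)
    show "cycle_length star x y dvd cycle_length star x z \<or> cycle_length star x z dvd cycle_length star x y"
      using increasing_divisor_chain[OF cl(1), of i j] increasing_divisor_chain[OF cl(1), of j i] ij
      by (cases "i \<le> j") auto
    assume "cycle_length star x y = cycle_length star x z"
    hence "orbit (right_translation X star x) y = orbit (right_translation X star x) z"
      using len[OF xyz(1,2)] len[OF xyz(1,3)]
      by (intro inj_onD[OF cl(2) _ imageI[OF xyz(2)] imageI[OF xyz(3)]]) simp
    thus "z \<in> orbit (rt star x) y"
      using orbit_right_translation[OF xyz(1,2)] orbit_right_translation[OF xyz(1,3)] self_in_cycle[OF xyz(1,3)]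
      by simp
  qed
  obtain x where x: "x \<in> X" using assms by (auto simp: SHQ_def)
  obtain c and l :: "nat \<Rightarrow> nat" where cl: "c \<ge> 2" "\<forall>i\<in>{2..c}. l (i - 1) < l i \<and> l (i - 1) dvd l i"
    "l 1 = 1" "card ` ?O x = l ` {1..c}" using *[OF x] by blast
  have "l 2 \<in> card ` ?O x" unfolding cl(4) using cl(1) by (intro imageI) simp
  then obtain y where y: "y \<in> X" "l 2 = card (orbit (right_translation X star x) y)"
    unfolding image_image by (elim imageE)
  have "l (2 - 1) < l 2" using cl(1,2) by force
  hence "l 2 > 1" using cl(3) by simp
  moreover have "card (orbit (rt star x) y) \<le> card X"
    using cycle_subset[OF x y(1)] finite by (intro card_mono)
  ultimately show "card X \<ge> 2" using y(2) orbit_right_translation[OF x y(1)] by simp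
qed

lemma (in chain_quandle) prof_geometric:
  assumes g: "geometric_lengths X (\<star>) l K" and l: "l > 1" and ne: "X \<noteq> {}"
  shows "prof X (\<star>) = 1 # map (\<lambda>k. l * (l + 1) ^ k) [0..<K]"
proof (rule prof_eqI[OF ne])
  fix x assume x: "x \<in> X"
  let ?O = "orbit (right_translation X (\<star>) x) ` X" and ?L = "1 # map (\<lambda>k. l * (l + 1) ^ k) [0..<K]"
  have len: "card (orbit (right_translation X (\<star>) x) y) = cycle_length (\<star>) x y" if "y \<in> X" for y
    using orbit_right_translation[OF x that] by (simp add: cycle_length_def)
  have "inj_on card ?O"
  proof (rule inj_onI)
    fix A B assume "A \<in> ?O" "B \<in> ?O" and eq: "card A = card B"
    then obtain y z where yz: "y \<in> X" "A = orbit (right_translation X (\<star>) x) y"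
      "z \<in> X" "B = orbit (right_translation X (\<star>) x) z" by (elim imageE)
    have "z \<in> orbit (rt (\<star>) x) y"
      using same_cycle[OF x yz(1,3)] eq len[OF yz(1)] len[OF yz(3)] yz(2,4) by simp
    thus "A = B"
      using orbit_eq_of_mem[OF rt_bij[OF x] finite yz(1)] orbit_right_translation[OF x yz(1)]
        orbit_right_translation[OF x yz(3)] yz(2,4) by simp
  qed
  hence "cycle_structure X (right_translation X (\<star>) x) = sorted_list_of_set (card ` ?O)"
    by (simp add: cycle_structure_def image_mset_mset_set)
  also have "card ` ?O = cycle_length (\<star>) x ` X"
    unfolding image_image using len by (intro image_cong refl)
  also have "\<dots> = set ?L"
    using g x by (simp add: geometric_lengths_def atLeast0LessThan)
  also have "sorted_list_of_set (set ?L) = ?L"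
  proof (rule sorted_list_of_set.idem_if_sorted_distinct)
    have ge: "1 < l * (l + 1) ^ k" for k
      using mult_le_mono2[OF one_le_power[of "l + 1" k], of l] l by linarith
    have "mono (\<lambda>k. l * (l + 1) ^ k)" by (intro monoI mult_le_mono2 power_increasing) simp_all
    hence "sorted (map (\<lambda>k. l * (l + 1) ^ k) [0..<K])"
      by (intro sorted_map_mono sorted_upt) (rule mono_imp_mono_on)
    thus "sorted ?L" using ge l by (auto intro: less_imp_le simp del: power_Suc mult_Suc)
    have "1 \<notin> (\<lambda>k. l * (l + 1) ^ k) ` {0..<K}"
    proof
      assume "1 \<in> (\<lambda>k. l * (l + 1) ^ k) ` {0..<K}"
      then obtain k where "1 = l * (l + 1) ^ k" by (elim imageE)
      thus False using ge[of k] by linarith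
    qed
    thus "distinct ?L" using geometric_inj[of l "{0..<K}"] l by (simp add: distinct_map)
  qed
  finally show "cycle_structure X (right_translation X (\<star>) x) = ?L" .
qed

lemma segment_exists:
  assumes "\<And>j. j \<in> {1..i} \<Longrightarrow> partial_sum l (j - 1) + l j = partial_sum l j" "k \<in> {1..partial_sum l i}"
  shows "\<exists>j\<in>{1..i}. k \<in> {partial_sum l j - l j + 1..partial_sum l j}"
  using assms
proof (induction i)
  case 0 thus ?case by (simp add: partial_sum_def)
next
  case (Suc i)
  show ?case
  proof (cases "k \<le> partial_sum l i")
    case True
    hence "\<exists>j\<in>{1..i}. k \<in> {partial_sum l j - l j + 1..partial_sum l j}"
      using Suc.prems(2) by (intro Suc.IH Suc.prems(1)) auto
    thus ?thesis by auto
  next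
    case False
    have "partial_sum l i + l (Suc i) = partial_sum l (Suc i)" using Suc.prems(1)[of "Suc i"] by simp
    hence "k \<in> {partial_sum l (Suc i) - l (Suc i) + 1..partial_sum l (Suc i)}"
      using False Suc.prems(2) by simp
    thus ?thesis by (intro bexI[of _ "Suc i"]) auto
  qed
qed

lemma partial_sum_step: "j \<ge> 1 \<Longrightarrow> partial_sum l (j - 1) + l j = partial_sum l j"
  by (cases j) (simp_all add: partial_sum_def)

lemma partial_sum_mono: "i \<le> j \<Longrightarrow> partial_sum l i \<le> partial_sum l j"
  unfolding partial_sum_def by (intro sum_mono2) auto

text \<open>The labels from \<open>n\<^sub>i - l\<^sub>i + 1\<close> to \<open>n\<^sub>i\<close> form one cycle of the translation by the element labelled \<open>1\<close>.\<close>

lemma (in finite_quandle) cycle_length_label: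
  assumes lab: "standard_labeling X (\<star>) c l lab" and card: "card X = partial_sum l c"
    and c: "c \<ge> 1" "l 1 = 1" and i: "i \<in> {1..c}" and pos: "l i > 0"
    and k: "k \<in> {partial_sum l i - l i + 1..partial_sum l i}"
  shows "cycle_length (\<star>) (lab 1) (lab k) = l i"
proof -
  have bij: "bij_betw lab {1..card X} X" using lab by (simp add: standard_labeling_def)
  have n1: "partial_sum l 1 = 1" using c(2) by (simp add: partial_sum_def)
  have n: "partial_sum l i \<le> card X" "1 \<le> card X"
    using partial_sum_mono[of i c l] partial_sum_mono[of 1 c l] i c(1) n1 card by auto
  have labX: "lab m \<in> X" if "m \<in> {1..card X}" for m using bij_betwE[OF bij] that by blast
  have x: "lab 1 \<in> X" using labX n(2) by simp
  let ?f = "rt (\<star>) (lab 1)" and ?s = "partial_sum l i - l i + 1" and ?n = "partial_sum l i"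
  have ls: "l i \<le> ?n" using partial_sum_step[of i l] i by simp
  have step: "?f (lab m) = lab (if m = ?n then ?s else m + 1)" if "m \<in> {?s..?n}" for m
  proof -
    have "right_translation X (\<star>) (lab 1) (lab m) = lab (if m = ?n then ?s else m + 1)"
      using lab i that unfolding standard_labeling_def by blast
    moreover have "lab m \<in> X" using labX that n(1) by simp
    ultimately show ?thesis by (simp add: right_translation_def)
  qed
  have pw: "(?f ^^ m) (lab ?s) = lab (?s + m)" if "m < l i" for m
    using that
  proof (induction m)
    case (Suc m)
    have "?s + m \<in> {?s..?n}" "?s + m \<noteq> ?n" using Suc.prems ls by auto
    thus ?case using Suc step[of "?s + m"] by simp
  qed simp
  have "(?f ^^ l i) (lab ?s) = ?f ((?f ^^ (l i - 1)) (lab ?s))" using pos by (cases "l i") simp_all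
  hence period: "(?f ^^ l i) (lab ?s) = lab ?s"
    using pw[of "l i - 1"] step[of ?n] ls pos by simp
  have orb: "orbit ?f (lab ?s) = lab ` {?s..?n}"
  proof -
    have "orbit ?f (lab ?s) = (\<lambda>m. (?f ^^ m) (lab ?s)) ` {..<l i}"
      unfolding orbit_altdef_bounded[OF period pos] by auto
    also have "\<dots> = (\<lambda>m. lab (?s + m)) ` {..<l i}" using pw by (intro image_cong) auto
    also have "\<dots> = lab ` (\<lambda>m. ?s + m) ` {..<l i}" by (simp only: image_image)
    also have "(\<lambda>m. ?s + m) ` {..<l i} = {?s..?n}"
    proof (intro equalityI subsetI)
      fix m assume "m \<in> {?s..?n}"
      thus "m \<in> (\<lambda>m. ?s + m) ` {..<l i}" using ls by (intro image_eqI[of _ _ "m - ?s"]) auto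
    qed (use ls in auto)
    finally show ?thesis .
  qed
  have "inj_on lab {?s..?n}"
    using bij_betw_imp_inj_on[OF bij] by (rule inj_on_subset) (use n(1) in auto)
  hence "card (orbit ?f (lab ?s)) = l i" unfolding orb using ls by (simp add: card_image)
  moreover have "lab ?s \<in> X" using labX n(1) ls pos by simp
  moreover have "lab k \<in> orbit ?f (lab ?s)" unfolding orb using k by (rule imageI)
  ultimately show ?thesis using cycle_length_of_mem[OF x, of "lab ?s" "lab k"] by (simp add: cycle_length_def)
qed

lemma (in finite_quandle) initial_part_eq_block:
  assumes lab: "standard_labeling X (\<star>) c l lab" and card: "card X = partial_sum l c"
    and chain: "\<forall>j\<in>{2..c}. l (j - 1) < l j \<and> l (j - 1) dvd l j" and l1: "l 1 = 1"
    and i: "i \<in> {1..c}"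
  shows "initial_part l lab i = block X (\<star>) (lab 1) (l i)"
proof -
  have bij: "bij_betw lab {1..card X} X" using lab by (simp add: standard_labeling_def)
  have pos: "l j > 0" if "j \<in> {1..c}" for j
    using increasing_divisor_chain[OF chain, of 1 j] that l1 by (cases "j = 1") auto
  have len: "cycle_length (\<star>) (lab 1) (lab k) = l j"
    if "j \<in> {1..c}" "k \<in> {partial_sum l j - l j + 1..partial_sum l j}" for j k
    using cycle_length_label[OF lab card _ l1 that(1) pos[OF that(1)] that(2)] i by simp
  have seg: "\<exists>j\<in>{1..m}. k \<in> {partial_sum l j - l j + 1..partial_sum l j}" if "k \<in> {1..partial_sum l m}" for k m
    using segment_exists[OF partial_sum_step that] by simp
  show ?thesis
  proof (intro equalityI subsetI)
    fix y assume "y \<in> initial_part l lab i"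
    then obtain k where k: "k \<in> {1..partial_sum l i}" "y = lab k" unfolding initial_part_def by (elim imageE)
    obtain j where j: "j \<in> {1..i}" "k \<in> {partial_sum l j - l j + 1..partial_sum l j}" using seg[OF k(1)] by auto
    have "cycle_length (\<star>) (lab 1) y dvd l i"
      using len[of j k] j i k(2) increasing_divisor_chain[OF chain, of j i] by auto
    moreover have "k \<in> {1..card X}" using k(1) partial_sum_mono[of i c l] i card by auto
    hence "y \<in> X" using bij_betwE[OF bij] k(2) by blast
    ultimately show "y \<in> block X (\<star>) (lab 1) (l i)" by (simp add: block_def)
  next
    fix y assume "y \<in> block X (\<star>) (lab 1) (l i)"
    hence y: "y \<in> X" "cycle_length (\<star>) (lab 1) y dvd l i" by (auto simp: block_def)
    have y_lab: "y \<in> lab ` {1..partial_sum l c}"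
      using y(1) bij_betw_imp_surj_on[OF bij] card by simp
    obtain k where k: "k \<in> {1..partial_sum l c}" "y = lab k"
      using y_lab by (elim imageE)
    obtain j where j: "j \<in> {1..c}" "k \<in> {partial_sum l j - l j + 1..partial_sum l j}" using seg[OF k(1)] by auto
    have "l j dvd l i" using len[OF j] y(2) k(2) by simp
    hence "l j \<le> l i" using pos[OF i] by (intro dvd_imp_le)
    hence "j \<le> i" using increasing_divisor_chain[OF chain, of i j] i j(1) by (cases "i < j") auto
    hence "k \<in> {1..partial_sum l i}" using partial_sum_mono[of j i l] j(2) by auto
    thus "y \<in> initial_part l lab i" unfolding initial_part_def k(2) by (rule imageI)
  qed
qed

theorem theorem3p10:
  fixes X :: "'a set" and star :: "'a \<Rightarrow> 'a \<Rightarrow> 'a"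
    and c :: nat and l :: "nat \<Rightarrow> nat" and lab :: "nat \<Rightarrow> 'a"
  assumes "c \<ge> 2"
    and "SHQ X star"
    and "prof X star = map l [1..<Suc c]"
    and "standard_labeling X star c l lab"
  shows "\<exists>p a :: nat. prime p \<and> a > 0 \<and>
    card X = (l 2 + 1) ^ (c - 1) \<and> l 2 + 1 = p ^ a \<and>
    prof X star = 1 # map (\<lambda>k. l 2 * (l 2 + 1) ^ k) [0..<c - 1] \<and>
    (\<forall>i\<in>{2..c}.
       subquandle (initial_part l lab i) X star \<and>
       connected_quandle (initial_part l lab i) star \<and>
       prof (initial_part l lab i) star = 1 # map (\<lambda>k. l 2 * (l 2 + 1) ^ k) [0..<i - 1]) \<and>
    (\<forall>Y. subquandle Y X star \<and> card Y \<ge> 2 \<longrightarrow>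
       (\<exists>i\<in>{2..c}. quandle_isomorphic Y star (initial_part l lab i) star))"
proof -
  have cq: "chain_quandle X star" and card2: "card X \<ge> 2" using SHQ_chain_quandle[OF assms(2)] by auto
  interpret hereditary_chain_quandle X star by (rule chain_quandle_hereditary[OF cq])
  have ne: "X \<noteq> {}" using card2 by auto
  obtain q K p a where geo: "q > 1" "K > 0" "geometric_lengths X star q K"
    and p: "prime p" "a > 0" "q + 1 = p ^ a"
    using chain_quandle_structure[OF cq card2] by blast
  have prof: "prof X star = 1 # map (\<lambda>k. q * (q + 1) ^ k) [0..<K]"
    by (rule prof_geometric[OF geo(3,1) ne])
  have eq: "map l [1..<Suc c] = 1 # map (\<lambda>k. q * (q + 1) ^ k) [0..<K]" using prof assms(3) by simp
  have K: "K = c - 1" using arg_cong[OF eq, of length] by (simp del: upt_Suc)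
  have l1: "l 1 = 1" using arg_cong[OF eq, of "\<lambda>L. L ! 0"] assms(1) by (simp del: upt_Suc)
  have l_val: "l (k + 2) = q * (q + 1) ^ k" if k: "k < c - 1" for k
  proof -
    have "map l [1..<Suc c] ! Suc k = (1 # map (\<lambda>k. q * (q + 1) ^ k) [0..<K]) ! Suc k" by (simp only: eq)
    thus ?thesis using k K by (simp del: upt_Suc)
  qed
  have l2: "l 2 = q" using l_val[of 0] assms(1) by (simp add: numeral_2_eq_2)
  have chain_l: "\<forall>j\<in>{2..c}. l (j - 1) < l j \<and> l (j - 1) dvd l j"
  proof
    fix j assume j: "j \<in> {2..c}"
    show "l (j - 1) < l j \<and> l (j - 1) dvd l j"
    proof (cases "j = 2")
      case True thus ?thesis using l1 l2 geo(1) by simp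
    next
      case False
      define k where "k = j - 3"
      have k: "j = k + 3" using False j by (auto simp: k_def)
      have "l (j - 1) = q * (q + 1) ^ k" "l j = q * (q + 1) ^ Suc k"
        using l_val[of k] l_val[of "Suc k"] j k by (simp_all add: numeral_3_eq_3)
      thus ?thesis using geo(1) by simp
    qed
  qed
  have psum: "partial_sum l (Suc m) = (q + 1) ^ m" if "m \<le> c - 1" for m
    using that
  proof (induction m)
    case 0 show ?case using l1 by (simp add: partial_sum_def)
  next
    case (Suc m)
    thus ?case using l_val[of m] partial_sum_step[of "Suc (Suc m)" l] by (simp add: algebra_simps)
  qed
  have card: "card X = (q + 1) ^ (c - 1)" using card_geometric[OF geo(3,1) ne] K by simp
  hence card_sum: "card X = partial_sum l c" using psum[of "c - 1"] assms(1) by simp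
  define x where "x = lab 1"
  have x: "x \<in> X"
    unfolding x_def using assms(4) card2 by (auto simp: standard_labeling_def bij_betw_def)
  have part: "initial_part l lab i = block X star x (q * (q + 1) ^ (i - 2))" if "i \<in> {2..c}" for i
  proof -
    have "i - 2 < c - 1" "i - 2 + 2 = i" using that by auto
    hence l_i: "l i = q * (q + 1) ^ (i - 2)" using l_val[of "i - 2"] by metis
    have "initial_part l lab i = block X star x (l i)"
      unfolding x_def using that by (intro initial_part_eq_block[OF assms(4) card_sum chain_l l1]) simp
    thus ?thesis unfolding l_i .
  qed
  show ?thesis
  proof (rule exI[of _ p], rule exI[of _ a], intro conjI ballI allI impI p(1,2))
    show "card X = (l 2 + 1) ^ (c - 1)" "l 2 + 1 = p ^ a"
      "prof X star = 1 # map (\<lambda>k. l 2 * (l 2 + 1) ^ k) [0..<c - 1]"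
      using card p(3) prof K l2 by simp_all
  next
    fix i assume i: "i \<in> {2..c}"
    let ?B = "block X star x (q * (q + 1) ^ (i - 2))"
    have B: "finite_quandle ?B star" by (rule block_quandle[OF x])
    have "i - 2 < K" "Suc (i - 2) = i - 1" using i K by auto
    hence gB: "geometric_lengths ?B star q (i - 1)"
      using geometric_block[OF geo(3,1) _ x, of "i - 2"] by metis
    show "subquandle (initial_part l lab i) X star"
      unfolding part[OF i] subquandle_def using block_subset finite_quandle.axioms(1)[OF B] by (rule conjI)
    show "connected_quandle (initial_part l lab i) star"
      unfolding part[OF i] by (rule connected_quandleI[OF B sub_indecomposable[OF B block_subset]])
    show "prof (initial_part l lab i) star = 1 # map (\<lambda>k. l 2 * (l 2 + 1) ^ k) [0..<i - 1]"
      unfolding part[OF i] l2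
      using self_in_block[OF x]
      by (intro chain_quandle.prof_geometric[OF chain_subquandle[OF B block_subset] gB geo(1)]) auto
  next
    fix Y assume Y: "subquandle Y X star \<and> card Y \<ge> 2"
    have YX: "Y \<subseteq> X" using Y by (simp add: subquandle_def)
    have fY: "finite_quandle Y star"
      using Y finite_subset[OF YX finite] unfolding subquandle_def
      by (intro finite_quandle.intro finite_quandle_axioms.intro) auto
    have "Y \<noteq> {}" using Y by auto
    then obtain y where y: "y \<in> Y" by auto
    have yX: "y \<in> X" using y YX by auto
    obtain z where z: "z \<in> Y" "Y = block X star y (cycle_length star y z)"
      using subquandle_is_block[OF fY YX y] by auto
    have zX: "z \<in> X" using z(1) YX by auto
    have "cycle_length star y z \<noteq> 1"
    proof
      assume 1: "cycle_length star y z = 1"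
      have "w = y" if "w \<in> Y" for w
        using that cycle_length_eq_1_iff[OF yX, of w] unfolding z(2) 1 by (simp add: block_def)
      hence "Y \<subseteq> {y}" by auto
      hence "card Y \<le> 1" using card_mono[of "{y}" Y] by simp
      thus False using Y by simp
    qed
    then obtain k where k: "k < K" "cycle_length star y z = q * (q + 1) ^ k"
      using geometric_cases[OF geo(3) yX zX] by auto
    have i: "k + 2 \<in> {2..c}" using k(1) K by auto
    have "quandle_isomorphic Y star (initial_part l lab (k + 2)) star"
      unfolding part[OF i] using blocks_isomorphic[OF x yX, of "q * (q + 1) ^ k"] z(2) k(2) by simp
    thus "\<exists>i\<in>{2..c}. quandle_isomorphic Y star (initial_part l lab i) star" using i by blast
  qed
qed

end
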